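(* Let $A\in\mathbf{C}^{n\times n}$ and $B\in\mathbf{C}^{n\times m}$ be such that the pair $(A,B)$ is stabilizable, and let $M\in\mathbf{C}^{(n+m)\times(n+m)}$ be a matrix of the form $M=M^*=\begin{bmatrix} W & V^*\\ V & R\end{bmatrix}$ with $R\in\mathbf{C}^{m\times m}$, $R>0$ (no definiteness of $M$ or $W$ is assumed). For $x_0\in\mathbf{C}^n$ and $u\in L^2(\mathbf{R}_+)$ (with values in $\mathbf{C}^m$), let $x(\cdot,x_0,u)$ denote the solution of $\dot x(t)=Ax(t)+Bu(t)$, $t\ge 0$, $x(0)=x_0$, and let $U=\{u\in L^2(\mathbf{R}_+) \mid x(\cdot,0,u)\in L^2(\mathbf{R}_+)\}$. Then the following statements are equivalent. (a) For all $u\in U$, $$J(0,u)=\int_0^\infty \begin{bmatrix} x(t,0,u)\\ u(t)\end{bmatrix}^* M \begin{bmatrix} x(t,0,u)\\ u(t)\end{bmatrix}\,dt\ \ge 0 .$$ (b) For all $\omega\in\mathbf{R}$ with $\imath\omega\notin\sigma(A)$, $$\Phi(\omega)=\begin{bmatrix} (\imath\omega I-A)^{-1}B\\ I\end{bmatrix}^* M \begin{bmatrix} (\imath\omega I-A)^{-1}B\\ I\end{bmatrix}\ \ge 0 .$$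
   Context: $\mathbf{R}_+=[0,\infty)$, $\imath$ is the imaginary unit, $\sigma(A)$ is the spectrum of $A$, and $X^*$ is the conjugate transpose of $X$. For Hermitian matrices, $X>0$ means positive definite and $X\ge 0$ means positive semidefinite. The pair $(A,B)$ is stabilizable if there is a matrix $F\in\mathbf{C}^{m\times n}$ such that all eigenvalues of $A+BF$ lie in the open left half plane. *)

theory Defs
  imports "HOL-Analysis.Analysis" "HOL-Library.Complex_Order"
begin

text \<open>
  A complex matrix with p rows and q columns has type \<open>complex ^ 'q ^ 'p\<close>; block matrices are
  indexed by sum types. The order on \<open>complex\<close> is the one of \<open>HOL-Library.Complex_Order\<close>, so
  \<open>0 \<le> z\<close> means that \<open>z\<close> is real and nonnegative, and \<open>0 < z\<close> that it is real and positive.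
\<close>

definition conj_transpose :: "complex ^ 'q ^ 'p \<Rightarrow> complex ^ 'p ^ 'q"
  where "conj_transpose X = (\<chi> i j. cnj (X $ j $ i))"

definition cquad :: "complex ^ 'p ^ 'p \<Rightarrow> complex ^ 'p \<Rightarrow> complex"
  where "cquad P v = (\<Sum>i\<in>UNIV. cnj (v $ i) * (P *v v) $ i)"

definition pos_def :: "complex ^ 'p ^ 'p \<Rightarrow> bool"
  where "pos_def P \<longleftrightarrow> conj_transpose P = P \<and> (\<forall>v. v \<noteq> 0 \<longrightarrow> 0 < cquad P v)"

definition pos_semidef :: "complex ^ 'p ^ 'p \<Rightarrow> bool"
  where "pos_semidef P \<longleftrightarrow> conj_transpose P = P \<and> (\<forall>v. 0 \<le> cquad P v)"

definition spectrum :: "complex ^ 'n ^ 'n \<Rightarrow> complex set"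
  where "spectrum A = {z. \<exists>v. v \<noteq> 0 \<and> A *v v = z *s v}"

definition stabilizable :: "complex ^ 'n ^ 'n \<Rightarrow> complex ^ 'm ^ 'n \<Rightarrow> bool"
  where "stabilizable A B \<longleftrightarrow>
    (\<exists>F :: complex ^ 'n ^ 'm. \<forall>z\<in>spectrum (A + B ** F). Re z < 0)"

text \<open>
  Since a matrix is the vector of its rows, \<open>vstack\<close> stacks column vectors as well as matrices
  (with equally many columns) on top of each other.
\<close>

definition vstack :: "'a ^ 'n \<Rightarrow> 'a ^ 'm \<Rightarrow> 'a ^ ('n + 'm)"
  where "vstack x y = (\<chi> k. case k of Inl i \<Rightarrow> x $ i | Inr j \<Rightarrow> y $ j)"

definition block_matrix ::
    "'a ^ 'n ^ 'n \<Rightarrow> 'a ^ 'm ^ 'n \<Rightarrow> 'a ^ 'n ^ 'm \<Rightarrow> 'a ^ 'm ^ 'm \<Rightarrow> 'a ^ ('n + 'm) ^ ('n + 'm)"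
  where "block_matrix P Q S T =
    vstack (\<chi> i. vstack (P $ i) (Q $ i)) (\<chi> j. vstack (S $ j) (T $ j))"

text \<open>
  Square-integrable functions on the half-line. Elements are functions, not classes modulo
  equality almost everywhere, and their values at negative times are irrelevant.
\<close>

definition L2_Rplus :: "(real \<Rightarrow> complex ^ 'p) set"
  where "L2_Rplus = {f. set_borel_measurable lebesgue {0..} f \<and>
                        set_integrable lebesgue {0..} (\<lambda>t. (norm (f t))\<^sup>2)}"

text \<open>
  Solutions of \<open>x' = A x + B u\<close>, \<open>x 0 = x0\<close> on the half-line in the sense of Caratheodory: as \<open>u\<close>
  is only measurable, the equation is required in integrated form, that is, \<open>x\<close> is locally
  absolutely continuous and satisfies the differential equation almost everywhere.
\<close>

definition is_solution ::
    "complex ^ 'n ^ 'n \<Rightarrow> complex ^ 'm ^ 'n \<Rightarrow> complex ^ 'n \<Rightarrow> (real \<Rightarrow> complex ^ 'm) \<Rightarrow>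
     (real \<Rightarrow> complex ^ 'n) \<Rightarrow> bool"
  where "is_solution A B x0 u x \<longleftrightarrow>
    (\<forall>t\<ge>0. set_integrable lebesgue {0..t} (\<lambda>s. A *v x s + B *v u s) \<and>
           x t = x0 + (LINT s:{0..t}|lebesgue. A *v x s + B *v u s))"

text \<open>
  For locally integrable \<open>u\<close> (in particular for \<open>u\<close> in \<open>L2_Rplus\<close>) a solution exists and any two
  agree on \<open>{0..}\<close>. The choice operator thus only fixes the values at negative times, which are
  never used below.
\<close>

definition state ::
    "complex ^ 'n ^ 'n \<Rightarrow> complex ^ 'm ^ 'n \<Rightarrow> complex ^ 'n \<Rightarrow> (real \<Rightarrow> complex ^ 'm) \<Rightarrow>
     real \<Rightarrow> complex ^ 'n"
  where "state A B x0 u = (SOME x. is_solution A B x0 u x)"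

definition admissible_inputs ::
    "complex ^ 'n ^ 'n \<Rightarrow> complex ^ 'm ^ 'n \<Rightarrow> (real \<Rightarrow> complex ^ 'm) set"
  where "admissible_inputs A B = {u \<in> L2_Rplus. state A B 0 u \<in> L2_Rplus}"

definition cost ::
    "complex ^ 'n ^ 'n \<Rightarrow> complex ^ 'm ^ 'n \<Rightarrow> complex ^ ('n + 'm) ^ ('n + 'm) \<Rightarrow>
     complex ^ 'n \<Rightarrow> (real \<Rightarrow> complex ^ 'm) \<Rightarrow> complex"
  where "cost A B M x0 u =
    (LINT t:{0..}|lebesgue. cquad M (vstack (state A B x0 u t) (u t)))"

definition popov ::
    "complex ^ 'n ^ 'n \<Rightarrow> complex ^ 'm ^ 'n \<Rightarrow> complex ^ ('n + 'm) ^ ('n + 'm) \<Rightarrow>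
     real \<Rightarrow> complex ^ 'm ^ 'm"
  where "popov A B M \<omega> =
    (let G = vstack (matrix_inv (mat (\<i> * of_real \<omega>) - A) ** B) (mat 1)
     in conj_transpose G ** M ** G)"

end

theory Submission
  imports Defs "HOL-Computational_Algebra.Fundamental_Theorem_Algebra"
    "HOL-Probability.Characteristic_Functions"
begin

text \<open>
  Fix a feedback \<open>F\<close> for which \<open>A + B F\<close> is stable. Any input on \<open>[0, T)\<close> can be continued by
  \<open>u = F x\<close>; state and input then decay exponentially, and the tail changes the cost by at most
  \<open>K |x(T)|\<^sup>2\<close> with \<open>K\<close> independent of \<open>T\<close> and of the input.

  Time to frequency: starting from \<open>x 0 = 0\<close>, the input \<open>u = e\<^sup>i\<^sup>\<omega>\<^sup>t w - F E(t) \<xi>\<close> with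
  \<open>\<xi> = (i\<omega> - A)\<^sup>-\<^sup>1 B w\<close> and \<open>E(t) = exp(t (A + B F))\<close> gives \<open>x = e\<^sup>i\<^sup>\<omega>\<^sup>t \<xi> - E(t) \<xi>\<close> on \<open>[0, T)\<close>, hence a
  cost \<open>T w\<^sup>* \<Phi>(\<omega>) w + O(1)\<close>, which must be nonnegative for all \<open>T\<close>.

  Frequency to time: if the input is continuous on \<open>[0, T)\<close>, then \<open>z = (x, u)\<close>, continued as above, is
  bounded, integrable and almost everywhere continuous, and its Fourier transform \<open>(X, U)\<close> satisfies
  \<open>i\<omega> X = A X + B U\<close>, so the form \<open>M\<close> is nonnegative at it. Averaging over a Gaussian frequency
  turns this into nonnegativity of the cost smoothed by a Gaussian in time; let its width tend to 0.
  Dominated convergence extends the resulting lower bound \<open>-K |x(T)|\<^sup>2\<close> for the cost on \<open>[0, T)\<close> to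
  square-integrable inputs, and \<open>x(T) \<rightarrow> 0\<close> along a sequence if the input is admissible.
\<close>

subsection \<open>Annihilating products and the matrix exponential\<close>

text \<open>Only stabilizability is assumed, so \<open>A\<close> may have eigenvalues on or to the
  right of the imaginary axis. Cutting an input off at T and continuing it by zero would then in
  general leave \<open>admissible_inputs\<close>, and an L2 perturbation of an admissible input need
  not be admissible. Approximation is therefore done on finite horizons only, and feedback repairs
  the tail. Eigenvalues on the axis exclude finitely many frequencies, a null set for the averages
  over frequency. Transforms of integrable functions are a priori merely bounded, so integrating the
  form over all frequencies would presuppose a Plancherel theorem. Against a Gaussian probability
  measure everything is integrable and Fubini applies. The limit is taken on the time side, where
  the jumps of the continued input form a null set. The term K |x(T)|^2 does not disappear at a
  fixed T. Since K does not depend on T, it becomes negligible at times where x(T) is small, and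
  such times exist because |x|^2 is integrable.\<close>

lemma mat_mult_nth: "(mat a ** P) $ i $ j = (a::'a::comm_semiring_1) * P $ i $ j"
  by (simp add: matrix_matrix_mult_def mat_def mult_delta_left mult_delta_right)

lemma mult_mat_nth: "(P ** mat a) $ i $ j = P $ i $ j * (a::'a::comm_semiring_1)"
  by (simp add: matrix_matrix_mult_def mat_def mult_delta_left mult_delta_right)

lemma mat_mult_mat: "mat a ** mat b = (mat (a * b) :: 'a::comm_semiring_1 ^'n^'n)"
  by (simp add: vec_eq_iff mat_mult_nth) (simp add: mat_def)

lemma mat_mult_commute: "P ** mat a = mat (a::'a::comm_semiring_1) ** P"
  by (simp add: vec_eq_iff mat_mult_nth mult_mat_nth mult.commute)

lemma mat_mult_vector: "mat a *v x = (a::'a::comm_semiring_1) *s x"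
  by (simp add: matrix_vector_mult_def mat_def vec_eq_iff mult_delta_left mult_delta_right)

lemma mat_add: "mat (a + b) = (mat a + mat b :: 'a::comm_semiring_1 ^'n^'n)"
  by (simp add: mat_def vec_eq_iff)

lemma matrix_diff_ldistrib: "A ** (B - C) = A ** B - A ** (C::'a::comm_ring_1^'n^'m)"
  by (simp add: matrix_matrix_mult_def vec_eq_iff sum_subtractf algebra_simps)

lemma matrix_diff_rdistrib: "(B - C) ** A = B ** A - C ** (A::'a::comm_ring_1^'n^'m)"
  by (simp add: matrix_matrix_mult_def vec_eq_iff sum_subtractf algebra_simps)

lemma matrix_add_rdistrib: "(B + C) ** A = B ** A + C ** (A::'a::comm_ring_1^'n^'m)"
  by (simp add: matrix_matrix_mult_def vec_eq_iff sum.distrib algebra_simps)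

text \<open>The accumulator \<open>P\<close> carries the partial product, which is exactly the
  matrix multiplying a scalar coefficient at that stage of Putzer's recursion.\<close>

primrec matprod :: "complex ^'n^'n \<Rightarrow> complex list \<Rightarrow> complex ^'n^'n \<Rightarrow> complex ^'n^'n" where
  "matprod A [] P = P"
| "matprod A (l # L) P = matprod A L ((A - mat l) ** P)"

lemma matprod_diff_commute: "(A - mat l) ** matprod A L P = matprod A L ((A - mat l) ** P)"
proof (induction L arbitrary: P)
  case (Cons m L)
  have "(A - mat l) ** (A - mat m) = (A - mat m) ** (A - mat l)"
    by (simp add: matrix_diff_ldistrib matrix_diff_rdistrib mat_mult_commute[of A] mat_mult_mat mult.commute)
  then show ?case
    by (simp add: Cons matrix_mul_assoc)
qed simp

lemma matprod_Cons_vec: "matprod A (l # L) (mat 1) *v w = A *v (matprod A L (mat 1) *v w) - l *s (matprod A L (mat 1) *v w)"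
proof -
  have "matprod A (l # L) (mat 1) = (A - mat l) ** matprod A L (mat 1)"
    by (simp add: matprod_diff_commute)
  then show ?thesis
    by (simp add: matrix_vector_mult_diff_rdistrib mat_mult_vector flip: matrix_vector_mul_assoc)
qed

lemma matprod_eigenvector:
  assumes "A *v v = z *s v"
  shows "matprod A L (mat 1) *v v = (\<Prod>l\<leftarrow>L. z - l) *s v"
proof (induction L)
  case (Cons l L)
  show ?case
    by (simp only: matprod_Cons_vec Cons)
       (simp add: vector_scalar_commute assms vector_smult_assoc vector_sub_rdistrib algebra_simps)
qed simp

lemma matprod_split: "matprod A (xs @ l # ys) P = (A - mat l) ** matprod A (xs @ ys) P"
  by (induction xs arbitrary: P) (simp_all add: matprod_diff_commute)

section \<open>Polynomials in a matrix and annihilating products\<close>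

primrec matpow :: "complex ^'n^'n \<Rightarrow> nat \<Rightarrow> complex ^'n^'n" where
  "matpow A 0 = mat 1"
| "matpow A (Suc k) = A ** matpow A k"

definition matpoly :: "complex poly \<Rightarrow> complex ^'n^'n \<Rightarrow> complex ^'n^'n" where
  "matpoly p A = fold_coeffs (\<lambda>a X. mat a + A ** X) p 0"

lemma matpoly_0 [simp]: "matpoly 0 A = 0"
  by (simp add: matpoly_def)

lemma matpoly_pCons [simp]: "matpoly (pCons a p) A = mat a + A ** matpoly p A"
  by (cases "p = 0 \<and> a = 0") (auto simp: matpoly_def)

lemma matpoly_add: "matpoly (p + q) A = matpoly p A + matpoly q A"
proof (induction p arbitrary: q)
  case (pCons a p)
  obtain b q' where "q = pCons b q'" by (cases q)
  then show ?case
    by (simp add: pCons mat_add matrix_add_ldistrib add_ac)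
qed simp

lemma matpoly_smult: "matpoly (smult c p) A = mat c ** matpoly p A"
proof (induction p)
  case (pCons a p)
  have "A ** (mat c ** matpoly p A) = mat c ** (A ** matpoly p A)"
    by (metis matrix_mul_assoc mat_mult_commute)
  then show ?case
    by (simp add: pCons matrix_add_ldistrib mat_mult_mat)
qed simp

lemma matpoly_mult_linear: "matpoly ([:-l, 1:] * p) A = (A - mat l) ** matpoly p A"
proof -
  have "[:-l, 1:] * p = smult (-l) p + pCons 0 p"
    by simp
  then have "matpoly ([:-l, 1:] * p) A = mat (-l) ** matpoly p A + A ** matpoly p A"
    by (simp only: matpoly_add matpoly_smult matpoly_pCons) simp
  also have "mat (-l) ** matpoly p A = - (mat l ** matpoly p A)"
    by (simp add: vec_eq_iff mat_mult_nth)
  finally show ?thesis by (simp add: matrix_diff_rdistrib)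
qed

lemma matpoly_monom: "matpoly (monom c k) A = mat c ** matpow A k"
proof (induction k)
  case (Suc k)
  show ?case
    by (simp add: monom_Suc Suc) (metis matrix_mul_assoc mat_mult_commute)
qed (simp add: monom_0)

lemma matpoly_sum: "finite I \<Longrightarrow> matpoly (\<Sum>i\<in>I. p i) A = (\<Sum>i\<in>I. matpoly (p i) A)"
  by (induction I rule: finite_induct) (simp_all add: matpoly_add)

text \<open>Dimension count: d + 1 powers of \<open>A\<close> lie in a real vector space of
  dimension d. Real coefficients of the relation are enough, since only some nonzero annihilator is
  wanted.\<close>

lemma exists_annihilating_poly: "\<exists>p. p \<noteq> 0 \<and> matpoly p A = (0 :: complex^'n^'n)"
proof -
  define d where "d = DIM(complex^'n^'n)"
  show ?thesis
  proof (cases "inj_on (matpow A) {..d}")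
    \<comment> \<open>Linear dependence is a property of the set of powers and cannot see
      repetitions, so equal powers are treated separately, by the difference of two
      monomials.\<close>
    case False
    then obtain i j where ij: "i \<noteq> j" "matpow A i = matpow A j"
      by (auto simp: inj_on_def)
    define p :: "complex poly" where "p = monom 1 i + monom (-1) j"
    have "coeff p i = 1" using ij by (simp add: p_def)
    then have "p \<noteq> 0" by auto
    moreover have "matpoly p A = 0"
      by (simp add: p_def matpoly_add matpoly_monom ij) (simp add: vec_eq_iff mat_mult_nth)
    ultimately show ?thesis by blast
  next
    case True
    have "card (matpow A ` {..d}) = Suc d"
      using True by (simp add: card_image)
    then have "dependent (matpow A ` {..d})"
      using independent_bound[of "matpow A ` {..d}"] by (auto simp: d_def)
    then obtain u k where u: "k \<le> d" "u (matpow A k) \<noteq> (0::real)"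
       "(\<Sum>v\<in>matpow A ` {..d}. u v *\<^sub>R v) = 0"
      by (auto simp: dependent_finite)
    define p :: "complex poly" where "p = (\<Sum>i\<le>d. monom (of_real (u (matpow A i))) i)"
    have "coeff p k = of_real (u (matpow A k))"
      using u(1) by (simp add: p_def coeff_sum)
    then have "p \<noteq> 0" using u(2) by auto
    moreover have "matpoly p A = (\<Sum>i\<le>d. u (matpow A i) *\<^sub>R matpow A i)"
      unfolding p_def by (subst matpoly_sum)
        (auto simp: matpoly_monom vec_eq_iff mat_mult_nth scaleR_conv_of_real[of _ "_ :: complex"] intro!: sum.cong)
    then have "matpoly p A = 0"
      using u(3) True by (simp add: sum.reindex)
    ultimately show ?thesis by blast
  qed
qed

text \<open>Over the complex numbers the annihilating polynomial splits into linear factors; its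
  nonzero leading constant can be cancelled.\<close>

lemma exists_annihilating_list: "\<exists>L. matprod A L (mat 1) = (0 :: complex^'n^'n)"
proof -
  have *: "\<exists>L. matprod A L (mat 1) = (0 :: complex^'n^'n)" if p0: "matpoly p A = 0" "p \<noteq> 0" for p
  proof -
    have "\<exists>c L. c \<noteq> 0 \<and> matpoly p A = mat c ** matprod A L (mat 1)" if "p \<noteq> 0" for p
      using that
    proof (induction "degree p" arbitrary: p)
      case 0
      then obtain c where c: "p = [:c:]" by (metis degree_0_id)
      then show ?case using 0 by (intro exI[of _ c] exI[of _ "[]"]) (auto simp: )
    next
      case (Suc n)
      then have "\<not> constant (poly p)" by (simp add: constant_degree)
      then obtain l where "poly p l = 0"
        using fundamental_theorem_of_algebra by blast
      then obtain q where q: "p = [:-l, 1:] * q"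
        by (auto simp: poly_eq_0_iff_dvd elim: dvdE)
      with Suc have "q \<noteq> 0" by auto
      then have "degree p = Suc (degree q)" unfolding q by (subst degree_mult_eq) auto
      then obtain c L where cL: "c \<noteq> 0" "matpoly q A = mat c ** matprod A L (mat 1)"
        using Suc.hyps \<open>q \<noteq> 0\<close> by (metis old.nat.inject)
      have "matpoly p A = (A - mat l) ** (mat c ** matprod A L (mat 1))"
        unfolding q matpoly_mult_linear cL(2) ..
      also have "\<dots> = mat c ** ((A - mat l) ** matprod A L (mat 1))"
        by (metis matrix_mul_assoc mat_mult_commute)
      finally show ?case using cL(1)
        by (intro exI[of _ c] exI[of _ "l # L"]) (simp add: matprod_diff_commute)
    qed
    then obtain c L where "c \<noteq> 0" "mat c ** matprod A L (mat 1) = 0"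
      using p0 by metis
    then have "matprod A L (mat 1) = 0"
      by (auto simp: vec_eq_iff mat_mult_nth)
    then show ?thesis by blast
  qed
  then show ?thesis using exists_annihilating_poly by blast
qed

text \<open>Take a shortest annihilating list. Each eigenvalue z occurs in it, because the product
  acts on an eigenvector as the scalar product of the z - l. Conversely, dropping an entry l leaves
  a nonzero matrix, and every nonzero vector in its range is an eigenvector for l. The decay
  hypothesis speaks of the spectrum only, so no foreign entries may remain.\<close>

lemma exists_spectral_list:
  obtains L where "matprod A L (mat 1) = (0 :: complex^'n^'n)" "set L = spectrum A"
proof -
  obtain L where L: "matprod A L (mat 1) = (0 :: complex^'n^'n)"
    and min: "\<And>L'. matprod A L' (mat 1) = (0 :: complex^'n^'n) \<Longrightarrow> length L \<le> length L'"
    using exists_annihilating_list ex_has_least_nat[of "\<lambda>L. matprod A L (mat 1) = 0" _ length] by metis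
  have "spectrum A \<subseteq> set L"
  proof
    fix z assume "z \<in> spectrum A"
    then obtain v where v: "v \<noteq> 0" "A *v v = z *s v" by (auto simp: spectrum_def)
    then have "(\<Prod>l\<leftarrow>L. z - l) *s v = 0"
      using matprod_eigenvector[of A v z L] L by simp
    then show "z \<in> set L" using v(1) by (auto simp: prod_list_zero_iff)
  qed
  moreover have "set L \<subseteq> spectrum A"
  proof
    fix l assume "l \<in> set L"
    then obtain xs ys where s: "L = xs @ l # ys" by (auto simp: in_set_conv_decomp)
    have "matprod A (xs @ ys) (mat 1) \<noteq> 0"
      using min[of "xs @ ys"] s by auto
    then obtain w where w: "matprod A (xs @ ys) (mat 1) *v w \<noteq> 0"
      by (metis matrix_eq matrix_vector_mult_0)
    have "(A - mat l) *v (matprod A (xs @ ys) (mat 1) *v w) = 0"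
      using L by (simp add: s matprod_split matrix_vector_mul_assoc)
    then show "l \<in> spectrum A"
      using w unfolding spectrum_def
      by (auto simp: matrix_vector_mult_diff_rdistrib mat_mult_vector)
  qed
  ultimately show thesis using that L by blast
qed

lemma finite_spectrum: "finite (spectrum A)"
  by (metis exists_spectral_list List.finite_set)

section \<open>Bilinearity of the matrix products and construction of the exponential\<close>

lemma bounded_bilinear_matrix_mult: "bounded_bilinear ((**) :: complex^'n^'m \<Rightarrow> complex^'k^'n \<Rightarrow> _)"
  unfolding bilinear_conv_bounded_bilinear[symmetric] bilinear_def
  by (auto intro!: linearI simp: matrix_add_ldistrib matrix_add_rdistrib)
     (auto simp: vec_eq_iff matrix_matrix_mult_def scaleR_sum_right)

lemma bounded_bilinear_matrix_vector: "bounded_bilinear ((*v) :: complex^'n^'m \<Rightarrow> _)"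
  unfolding bilinear_conv_bounded_bilinear[symmetric] bilinear_def
  by (auto intro!: linearI simp: matrix_vector_right_distrib matrix_vector_mult_add_rdistrib)
     (auto simp: vec_eq_iff matrix_vector_mult_def scaleR_sum_right)

lemma bounded_linear_mat: "bounded_linear (mat :: complex \<Rightarrow> complex^'n^'n)"
  by (intro linear_conv_bounded_linear[THEN iffD1] linearI) (auto simp: vec_eq_iff mat_def)

lemmas matrix_mult_has_vector_derivative = bounded_bilinear.has_vector_derivative[OF bounded_bilinear_matrix_mult]
lemmas matrix_vector_has_vector_derivative = bounded_bilinear.has_vector_derivative[OF bounded_bilinear_matrix_vector]
lemmas continuous_on_matrix_vector [continuous_intros] = bounded_bilinear.continuous_on[OF bounded_bilinear_matrix_vector]
lemmas mat_has_vector_derivative = bounded_linear.has_vector_derivative[OF bounded_linear_mat]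

text \<open>Scalar variation of constants. Because Re l lies strictly below -c, the rate c passes
  unchanged from \<open>r\<close> to \<open>s\<close> at the price of a constant factor; iterating
  along a list with repeated entries then produces no polynomial factors.\<close>

lemma putzer_scalar:
  fixes r :: "real \<Rightarrow> complex"
  assumes "continuous_on UNIV r"
  obtains s where "s 0 = 0" "\<And>t. (s has_vector_derivative (l * s t + r t)) (at t)"
    "\<And>C c. Re l < - c \<Longrightarrow> (\<And>t. 0 \<le> t \<Longrightarrow> norm (r t) \<le> C * exp (- c * t)) \<Longrightarrow>
       \<exists>D. \<forall>t\<ge>0. norm (s t) \<le> D * exp (- c * t)"
proof -
  define h where "h t = exp (- l * of_real t) * r t" for t
  have hc: "continuous_on S h" for S
    unfolding h_def by (intro continuous_intros continuous_on_subset[OF assms]) auto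
  \<comment> \<open>Negative times are needed as well: \<open>E (- t)\<close> later serves as the
    inverse of \<open>E t\<close>.\<close>
  define g where "g t = (if t \<ge> 0 then integral {0..t} h else - integral {t..0} h)" for t
  have g': "(g has_vector_derivative h t) (at t)" for t
  proof -
    define N where "N = \<bar>t\<bar> + 1"
    have N: "N > 0" "t \<in> {-N<..<N}" by (auto simp: N_def)
    define k where "k u = integral {-N..u} h" for u
    have io: "h integrable_on {a..b}" for a b
      using hc integrable_continuous_interval by blast
    have gk: "g u = k u - k 0" if "u \<in> {-N<..<N}" for u
    proof (cases "u \<ge> 0")
      case True
      then have "integral {-N..0} h + integral {0..u} h = integral {-N..u} h"
        using N by (intro Henstock_Kurzweil_Integration.integral_combine io) auto
      then show ?thesis using True by (simp add: g_def k_def algebra_simps)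
    next
      case False
      then have "integral {-N..u} h + integral {u..0} h = integral {-N..0} h"
        using N that by (intro Henstock_Kurzweil_Integration.integral_combine io) auto
      then show ?thesis using False by (simp add: g_def k_def algebra_simps)
    qed
    have "(k has_vector_derivative h t) (at t within {-N..N})"
      unfolding k_def using N by (intro integral_has_vector_derivative hc) auto
    then have "(k has_vector_derivative h t) (at t)"
      using N by (metis at_within_interior interior_atLeastAtMost_real)
    then have "((\<lambda>u. k u - k 0) has_vector_derivative h t) (at t)"
      by (auto intro!: derivative_eq_intros)
    then show ?thesis
      by (rule has_vector_derivative_transform_within_open[of _ _ _ "{-N<..<N}"]) (use N gk in auto)
  qed
  define s where "s t = exp (l * of_real t) * g t" for t
  show thesis
  proof
    show "s 0 = 0" by (simp add: s_def g_def)
  next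
    fix t
    have "((\<lambda>t. exp (l * of_real t)) has_vector_derivative (l * exp (l * of_real t))) (at t)"
      by (rule has_vector_derivative_real_field) (auto intro!: derivative_eq_intros)
    from has_vector_derivative_mult[OF this g']
    have "(s has_vector_derivative (exp (l * of_real t) * h t + l * exp (l * of_real t) * g t)) (at t)"
      unfolding s_def .
    moreover have "exp (l * of_real t) * h t = r t"
      by (simp add: h_def exp_minus mult.assoc[symmetric])
    ultimately show "(s has_vector_derivative (l * s t + r t)) (at t)"
      by (simp add: s_def algebra_simps)
  next
    fix C c assume l: "Re l < -c" and r: "\<And>t. 0 \<le> t \<Longrightarrow> norm (r t) \<le> C * exp (- c * t)"
    \<comment> \<open>The integrand of \<open>g\<close> is bounded by C exp (\<delta> u);
      integrating it yields the factor 1 / \<delta>, which is why the gap has to be strict.\<close>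
    define \<delta> where "\<delta> = - c - Re l"
    have \<delta>: "\<delta> > 0" using l by (simp add: \<delta>_def)
    have C: "C \<ge> 0" using order_trans[OF norm_ge_zero r[of 0]] by simp
    have "norm (s t) \<le> (C / \<delta>) * exp (- c * t)" if "t \<ge> 0" for t
    proof -
      have "norm (integral {0..t} h) \<le> integral {0..t} (\<lambda>u. C * exp (\<delta> * u))"
      proof (rule integral_norm_bound_integral)
        show "h integrable_on {0..t}" using hc integrable_continuous_interval by blast
        show "(\<lambda>u. C * exp (\<delta> * u)) integrable_on {0..t}"
          by (intro integrable_continuous_interval continuous_intros)
        fix u assume u: "u \<in> {0..t}"
        then have "norm (h u) \<le> exp (- Re l * u) * (C * exp (- c * u))"
          using r[of u] by (auto simp: h_def norm_mult intro!: mult_left_mono)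
        also have "\<dots> = C * exp (\<delta> * u)"
          by (simp add: \<delta>_def exp_add[symmetric] algebra_simps)
        finally show "norm (h u) \<le> C * exp (\<delta> * u)" .
      qed
      also have "integral {0..t} (\<lambda>u. C * exp (\<delta> * u)) = C / \<delta> * exp (\<delta> * t) - C / \<delta> * exp (\<delta> * 0)"
        using \<delta> that by (intro integral_unique fundamental_theorem_of_calculus)
          (auto intro!: derivative_eq_intros simp flip: has_real_derivative_iff_has_vector_derivative)
      also have "\<dots> \<le> C / \<delta> * exp (\<delta> * t)" using C \<delta> by simp
      finally have "norm (g t) \<le> C / \<delta> * exp (\<delta> * t)" using that by (simp add: g_def)
      from mult_left_mono[OF this, of "exp (Re l * t)"]
      have "norm (s t) \<le> exp (Re l * t) * (C / \<delta> * exp (\<delta> * t))"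
        by (simp add: s_def norm_mult)
      also have "\<dots> = (C / \<delta>) * exp (- c * t)"
        by (simp add: \<delta>_def exp_add[symmetric] algebra_simps)
      finally show ?thesis .
    qed
    then show "\<exists>D. \<forall>t\<ge>0. norm (s t) \<le> D * exp (- c * t)" by blast
  qed
qed

text \<open>Putzer's algorithm: the matrix exponential is a combination of the partial products of an
  annihilating product \<open>(A - l\<^sub>1) \<cdots> (A - l\<^sub>k)\<close>, with scalar coefficients solving \<open>s' = l\<^sub>j s + r\<close>; the
  coefficients decay if all \<open>l\<^sub>j\<close> lie in the open left half plane.\<close>

lemma putzer_matrix:
  fixes A P :: "complex^'n^'n" and r :: "real \<Rightarrow> complex"
  assumes "continuous_on UNIV r" "A ** P = P ** A"
  shows "\<exists>X \<rho>. X 0 = 0 \<and> (\<forall>t. A ** X t = X t ** A) \<and>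
    (\<forall>t. (X has_vector_derivative (A ** X t + mat (r t) ** P - mat (\<rho> t) ** matprod A L P)) (at t)) \<and>
    (\<forall>C c. (\<forall>l\<in>set L. Re l < - c) \<longrightarrow> (\<forall>t\<ge>0. norm (r t) \<le> C * exp (- c * t)) \<longrightarrow>
       (\<exists>D. \<forall>t\<ge>0. norm (X t) \<le> D * exp (- c * t)))"
  using assms
proof (induction L arbitrary: r P)
  \<comment> \<open>With no factors left, X = 0 works and the forcing itself becomes the residual
    coefficient \<rho>. The residual always multiplies the full product, so it vanishes once that
    product is zero.\<close>
  case Nil
  show ?case
    by (intro exI[of _ "\<lambda>t. 0"] exI[of _ r]) (auto intro!: exI[of _ 0])
next
  case (Cons l L)
  obtain s where s: "s 0 = 0" "\<And>t. (s has_vector_derivative (l * s t + r t)) (at t)"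
    "\<And>C c. Re l < - c \<Longrightarrow> (\<And>t. 0 \<le> t \<Longrightarrow> norm (r t) \<le> C * exp (- c * t)) \<Longrightarrow>
       \<exists>D. \<forall>t\<ge>0. norm (s t) \<le> D * exp (- c * t)"
    using putzer_scalar[OF Cons.prems(1)] by metis
  have sc: "continuous_on UNIV s"
    using s(2) by (meson continuous_at_imp_continuous_on has_vector_derivative_continuous)
  define P' where "P' = (A - mat l) ** P"
  have P': "A ** P' = P' ** A"
    unfolding P'_def using Cons.prems(2)
    by (simp add: matrix_diff_rdistrib matrix_diff_ldistrib matrix_mul_assoc[symmetric])
       (metis matrix_mul_assoc mat_mult_commute)
  obtain X \<rho> where X: "X 0 = 0" "\<And>t. A ** X t = X t ** A"
    "\<And>t. (X has_vector_derivative (A ** X t + mat (s t) ** P' - mat (\<rho> t) ** matprod A L P')) (at t)"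
    "\<And>C c. (\<forall>l\<in>set L. Re l < - c) \<Longrightarrow> (\<forall>t\<ge>0. norm (s t) \<le> C * exp (- c * t)) \<Longrightarrow>
       (\<exists>D. \<forall>t\<ge>0. norm (X t) \<le> D * exp (- c * t))"
    using Cons.IH[OF sc P'] by metis
  \<comment> \<open>The derivative of s P is l s P + r P. Apart from r P this falls short of A (s P)
    by s (A - l) P = s P', which is precisely the forcing in the equation for
    \<open>X\<close>.\<close>
  define Y where "Y t = mat (s t) ** P + X t" for t
  have com: "A ** (mat a ** P) = mat a ** P ** A" for a
    by (metis matrix_mul_assoc mat_mult_commute Cons.prems(2))
  have "(Y has_vector_derivative (A ** Y t + mat (r t) ** P - mat (\<rho> t) ** matprod A (l # L) P)) (at t)" for t
  proof -
    have "((\<lambda>t. mat (s t)) has_vector_derivative mat (l * s t + r t)) (at t)"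
      by (rule mat_has_vector_derivative[OF s(2)])
    from has_vector_derivative_add[OF matrix_mult_has_vector_derivative[OF this has_vector_derivative_const[of P]] X(3)]
    have "(Y has_vector_derivative (mat (l * s t + r t) ** P +
        (A ** X t + mat (s t) ** P' - mat (\<rho> t) ** matprod A L P'))) (at t)"
      unfolding Y_def by simp
    moreover have "mat (s t) ** P' = A ** (mat (s t) ** P) - mat (l * s t) ** P"
    proof -
      have "mat (s t) ** P' = mat (s t) ** (A ** P) - mat (s t * l) ** P"
        by (simp only: P'_def matrix_diff_rdistrib matrix_diff_ldistrib matrix_mul_assoc mat_mult_mat)
      also have "mat (s t) ** (A ** P) = A ** (mat (s t) ** P)"
        by (metis matrix_mul_assoc mat_mult_commute)
      finally show ?thesis by (simp add: mult.commute)
    qed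
    then have "mat (l * s t + r t) ** P + (A ** X t + mat (s t) ** P' - mat (\<rho> t) ** matprod A L P')
       = A ** Y t + mat (r t) ** P - mat (\<rho> t) ** matprod A (l # L) P"
      by (simp add: Y_def P'_def[symmetric] matrix_add_ldistrib matrix_add_rdistrib mat_add)
    ultimately show ?thesis by simp
  qed
  moreover have "Y 0 = 0" by (simp add: Y_def X s)
  moreover have "A ** Y t = Y t ** A" for t
    by (simp add: Y_def matrix_add_ldistrib matrix_add_rdistrib com X)
  moreover have "\<exists>D. \<forall>t\<ge>0. norm (Y t) \<le> D * exp (- c * t)"
    if c: "\<forall>l\<in>set (l # L). Re l < - c" "\<forall>t\<ge>0. norm (r t) \<le> C * exp (- c * t)" for C c
  proof -
    obtain D1 where D1: "\<forall>t\<ge>0. norm (s t) \<le> D1 * exp (- c * t)"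
      using s(3)[of c C] c by auto
    then obtain D2 where D2: "\<forall>t\<ge>0. norm (X t) \<le> D2 * exp (- c * t)"
      using X(4)[of c D1] c by auto
    have "bounded_linear (\<lambda>a. mat a ** P)"
      by (rule bounded_linear_compose[OF bounded_bilinear.bounded_linear_left[OF bounded_bilinear_matrix_mult] bounded_linear_mat])
    then obtain K where K: "K > 0" "\<And>a. norm (mat a ** P) \<le> norm a * K"
      using bounded_linear.pos_bounded by blast
    have "norm (Y t) \<le> (D1 * K + D2) * exp (- c * t)" if "t \<ge> 0" for t
    proof -
      have "norm (Y t) \<le> norm (s t) * K + norm (X t)"
        unfolding Y_def by (metis K(2) norm_triangle_mono order_refl)
      also have "\<dots> \<le> D1 * exp (- c * t) * K + D2 * exp (- c * t)"
        using D1 D2 that K(1) by (intro add_mono mult_right_mono) auto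
      finally show ?thesis by (simp add: algebra_simps)
    qed
    then show ?thesis by blast
  qed
  ultimately show ?case by blast
qed

text \<open>\<open>putzer_matrix\<close> starts at zero, whereas the exponential starts at the
  identity. The first coefficient exp (l t), with initial value 1, is therefore split off, and the
  recursion runs over the remaining list with accumulator A - l.\<close>

lemma matrix_exponential:
  fixes A :: "complex^'n^'n"
  obtains E where "E 0 = mat 1" "\<And>t. A ** E t = E t ** A"
    "\<And>t. (E has_vector_derivative (A ** E t)) (at t)"
    "\<And>c. (\<forall>z\<in>spectrum A. Re z < - c) \<Longrightarrow> \<exists>D. \<forall>t\<ge>0. norm (E t) \<le> D * exp (- c * t)"
proof -
  obtain L where L: "matprod A L (mat 1) = 0" "set L = spectrum A"
    using exists_spectral_list by blast
  have "(mat 1 :: complex^'n^'n) \<noteq> 0" by (simp add: vec_eq_iff mat_def)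
  with L(1) obtain l L' where L': "L = l # L'" by (cases L) auto
  define r where "r t = exp (l * of_real t)" for t :: real
  have rc: "continuous_on UNIV r" unfolding r_def by (intro continuous_intros)
  have r': "(r has_vector_derivative (l * r t)) (at t)" for t
    unfolding r_def by (rule has_vector_derivative_real_field) (auto intro!: derivative_eq_intros)
  have com: "A ** (A - mat l) = (A - mat l) ** A"
    by (simp add: matrix_diff_ldistrib matrix_diff_rdistrib mat_mult_commute[of A])
  obtain X \<rho> where X: "X 0 = 0" "\<And>t. A ** X t = X t ** A"
    "\<And>t. (X has_vector_derivative (A ** X t + mat (r t) ** (A - mat l) - mat (\<rho> t) ** matprod A L' (A - mat l))) (at t)"
    "\<And>C c. (\<forall>l\<in>set L'. Re l < - c) \<Longrightarrow> (\<forall>t\<ge>0. norm (r t) \<le> C * exp (- c * t)) \<Longrightarrow>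
       (\<exists>D. \<forall>t\<ge>0. norm (X t) \<le> D * exp (- c * t))"
    using putzer_matrix[OF rc com, of L'] by metis
  define E where "E t = mat (r t) + X t" for t
  show thesis
  proof
    show "E 0 = mat 1" by (simp add: E_def X r_def)
    show "A ** E t = E t ** A" for t
      by (simp add: E_def X matrix_add_ldistrib matrix_add_rdistrib mat_mult_commute[of A])
    show "(E has_vector_derivative (A ** E t)) (at t)" for t
    proof -
      have "matprod A L' (A - mat l) = 0" using L(1) L' by simp
      then have "(E has_vector_derivative (mat (l * r t) + (A ** X t + mat (r t) ** (A - mat l)))) (at t)"
        unfolding E_def using has_vector_derivative_add[OF mat_has_vector_derivative[OF r'] X(3)] by simp
      moreover have "mat (l * r t) + (A ** X t + mat (r t) ** (A - mat l)) = A ** E t"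
        by (simp add: E_def matrix_add_ldistrib matrix_diff_ldistrib mat_mult_mat mat_mult_commute[of A] mult.commute)
      ultimately show ?thesis by simp
    qed
    fix c assume c: "\<forall>z\<in>spectrum A. Re z < - c"
    then have "\<forall>l\<in>set L'. Re l < - c" "Re l < - c" using L L' by auto
    have r1: "norm (r t) \<le> 1 * exp (- c * t)" if "t \<ge> 0" for t
      using \<open>Re l < - c\<close> that mult_right_mono[of "Re l" "-c" t] by (simp add: r_def)
    then obtain D where D: "\<forall>t\<ge>0. norm (X t) \<le> D * exp (- c * t)"
      using X(4)[of c 1] \<open>\<forall>l\<in>set L'. _\<close> by auto
    obtain K where K: "K > 0" "\<And>a. norm (mat a :: complex^'n^'n) \<le> norm a * K"
      using bounded_linear.pos_bounded[OF bounded_linear_mat] by blast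
    have "norm (E t) \<le> (K + D) * exp (- c * t)" if "t \<ge> 0" for t
    proof -
      have "norm (E t) \<le> norm (r t) * K + norm (X t)"
        unfolding E_def by (metis K(2) norm_triangle_mono order_refl)
      also have "\<dots> \<le> 1 * exp (- c * t) * K + D * exp (- c * t)"
        using D r1 that K(1) by (intro add_mono mult_right_mono) auto
      finally show ?thesis by (simp add: algebra_simps)
    qed
    then show "\<exists>D. \<forall>t\<ge>0. norm (E t) \<le> D * exp (- c * t)" by blast
  qed
qed

subsection \<open>Gaussian averages of Fourier transforms\<close>

lemma borel_measurable_cnj [measurable]: "cnj \<in> borel_measurable borel"
  by (intro borel_measurable_continuous_onI continuous_intros)

definition fourier :: "(real \<Rightarrow> complex) \<Rightarrow> real \<Rightarrow> complex" where
  "fourier f \<omega> = (LINT t|lborel. iexp (- (\<omega> * t)) * f t)"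

lemma integrable_iexp_mult:
  assumes "integrable lborel f"
  shows "integrable lborel (\<lambda>t. iexp (- (\<omega> * t)) * f t)"
proof (rule Bochner_Integration.integrable_bound[OF assms])
  show "(\<lambda>t. iexp (- (\<omega> * t)) * f t) \<in> borel_measurable lborel"
    using assms by measurable
qed (simp add: norm_mult)

lemma borel_measurable_fourier [measurable (raw)]:
  assumes [measurable]: "f \<in> borel_measurable borel" and h: "h \<in> borel_measurable M"
  shows "(\<lambda>x. fourier f (h x)) \<in> borel_measurable M"
proof -
  have "(\<lambda>\<omega>. LINT t|lborel. iexp (- (\<omega> * t)) * f t) \<in> borel_measurable borel"
    by (rule lborel.borel_measurable_lebesgue_integral) measurable
  then show ?thesis
    unfolding fourier_def using measurable_compose[OF h] by blast
qed

lemma norm_fourier_le: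
  assumes "integrable lborel f"
  shows "norm (fourier f \<omega>) \<le> (LINT t|lborel. norm (f t))"
  unfolding fourier_def
  using integral_norm_bound[of lborel "\<lambda>t. iexp (- (\<omega> * t)) * f t"] by (simp add: norm_mult)

lemma prob_space_std_normal: "prob_space std_normal_distribution"
  using real_dist_normal_dist by (simp add: real_distribution_def)

lemma integrable_fourier_product:
  assumes f: "integrable lborel f" and g: "integrable lborel g"
  shows "integrable std_normal_distribution (\<lambda>\<omega>. cnj (fourier f (s * \<omega>)) * fourier g (s * \<omega>))"
proof -
  interpret N: prob_space std_normal_distribution by (rule prob_space_std_normal)
  have [measurable]: "f \<in> borel_measurable borel" "g \<in> borel_measurable borel"
    using f g by auto
  show ?thesis
  proof (rule N.integrable_const_bound)
    show "(\<lambda>\<omega>. cnj (fourier f (s * \<omega>)) * fourier g (s * \<omega>)) \<in> borel_measurable std_normal_distribution"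
      by measurable
    show "AE \<omega> in std_normal_distribution. norm (cnj (fourier f (s * \<omega>)) * fourier g (s * \<omega>))
       \<le> (LINT t|lborel. norm (f t)) * (LINT t|lborel. norm (g t))"
      by (auto simp: norm_mult intro!: mult_mono norm_fourier_le f g)
  qed
qed

text \<open>Averaging over a Gaussian frequency of variance \<open>s\<^sup>2\<close> is a convolution with a Gaussian of
  variance \<open>1 / s\<^sup>2\<close> in the time domain.\<close>

lemma gaussian_average_fourier:
  fixes f g :: "real \<Rightarrow> complex" and s :: real
  assumes f: "integrable lborel f" and g: "integrable lborel g" and s: "s > 0"
  shows "s / sqrt (2 * pi) * (LINT \<omega>|std_normal_distribution. cnj (fourier f (s * \<omega>)) * fourier g (s * \<omega>))
    = (LINT t|lborel. cnj (f t) * (LINT r|lborel. std_normal_density r * g (t + r / s)))"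
proof -
  interpret N: prob_space std_normal_distribution by (rule prob_space_std_normal)
  interpret P: pair_sigma_finite lborel std_normal_distribution ..
  have [measurable]: "f \<in> borel_measurable borel" "g \<in> borel_measurable borel"
    using f g by auto
  have mb: "(\<lambda>p. h (fst p) (snd p)) \<in> borel_measurable (lborel \<Otimes>\<^sub>M std_normal_distribution)"
    if "(\<lambda>p. h (fst p) (snd p)) \<in> borel_measurable (borel \<Otimes>\<^sub>M borel)" for h :: "real \<Rightarrow> real \<Rightarrow> complex"
    using that by (subst measurable_cong_sets[OF sets_pair_measure_cong refl]) auto
  have inner: "(LINT \<omega>|std_normal_distribution. iexp (s * \<omega> * t) * fourier g (s * \<omega>))
      = sqrt (2 * pi) / s * (LINT r|lborel. std_normal_density r * g (t + r / s))" for t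
  proof -
    define h where "h u \<omega> = iexp (s * \<omega> * (t - u)) * g u" for u \<omega>
    have hn: "norm (h u \<omega>) = norm (g u)" for u \<omega>
      by (simp add: h_def norm_mult)
    have hm [measurable]: "(\<lambda>(u, \<omega>). h u \<omega>) \<in> borel_measurable (lborel \<Otimes>\<^sub>M std_normal_distribution)"
      unfolding h_def case_prod_beta by (rule mb) measurable
    have hi: "integrable (lborel \<Otimes>\<^sub>M std_normal_distribution) (\<lambda>(u, \<omega>). h u \<omega>)"
    proof (rule P.Fubini_integrable)
      show "integrable lborel (\<lambda>u. LINT \<omega>|std_normal_distribution. norm (case (u, \<omega>) of (u, \<omega>) \<Rightarrow> h u \<omega>))"
        using g by (simp add: hn N.prob_space[simplified])
      show "AE u in lborel. integrable std_normal_distribution (\<lambda>\<omega>. case (u, \<omega>) of (u, \<omega>) \<Rightarrow> h u \<omega>)"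
      proof (rule AE_I2)
        fix u
        have "(\<lambda>\<omega>. h u \<omega>) \<in> borel_measurable std_normal_distribution"
          unfolding h_def by measurable
        then show "integrable std_normal_distribution (\<lambda>\<omega>. case (u, \<omega>) of (u, \<omega>) \<Rightarrow> h u \<omega>)"
          by (intro N.integrable_const_bound[of _ "norm (g u)"]) (auto simp: hn)
      qed
    qed measurable
    have "iexp (s * \<omega> * t) * fourier g (s * \<omega>) = (LINT u|lborel. h u \<omega>)" for \<omega>
    proof -
      have "iexp (s * \<omega> * t) * (iexp (- (s * \<omega> * u)) * g u) = h u \<omega>" for u
        by (simp add: h_def algebra_simps exp_diff exp_minus field_simps)
      then show ?thesis
        unfolding fourier_def by (simp flip: integral_mult_right_zero)
    qed
    then have "(LINT \<omega>|std_normal_distribution. iexp (s * \<omega> * t) * fourier g (s * \<omega>))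
       = (LINT u|lborel. LINT \<omega>|std_normal_distribution. h u \<omega>)"
      using P.Fubini_integral[OF hi] by simp
    \<comment> \<open>The integral over the frequency is the characteristic function of the standard
      normal law at s (t - u), again a Gaussian.\<close>
    also have "(LINT \<omega>|std_normal_distribution. h u \<omega>) = complex_of_real (exp (- (s * (t - u))\<^sup>2 / 2)) * g u" for u
    proof -
      have "(LINT \<omega>|std_normal_distribution. h u \<omega>) = char std_normal_distribution (s * (t - u)) * g u"
        unfolding h_def char_def by (simp add: mult_ac)
      then show ?thesis by (simp add: char_std_normal_distribution)
    qed
    then have "(LINT u|lborel. LINT \<omega>|std_normal_distribution. h u \<omega>)
       = (LINT u|lborel. complex_of_real (exp (- (s * (t - u))\<^sup>2 / 2)) * g u)" by simp
    \<comment> \<open>The substitution u = t + r / s removes \<open>s\<close> from the Gaussian; 1 /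
      s is the Jacobian and sqrt (2 pi) the normalization of the density.\<close>
    also have "\<dots> = \<bar>1 / s\<bar> *\<^sub>R (LINT r|lborel. complex_of_real (exp (- (s * (t - (t + 1 / s * r)))\<^sup>2 / 2)) * g (t + 1 / s * r))"
      using s by (intro lborel_integral_real_affine) simp
    also have "\<dots> = sqrt (2 * pi) / s * (LINT r|lborel. std_normal_density r * g (t + r / s))"
    proof -
      have "complex_of_real (exp (- (s * (t - (t + 1 / s * r)))\<^sup>2 / 2)) * g (t + 1 / s * r)
         = complex_of_real (sqrt (2 * pi)) * (std_normal_density r * g (t + r / s))" for r
        using s by (simp add: std_normal_density_def)
      then show ?thesis using s by (simp only: integral_mult_right_zero) (simp add: scaleR_conv_of_real)
    qed
    finally show ?thesis .
  qed
  \<comment> \<open>For the second use of Fubini the transform of \<open>g\<close> stays unexpanded: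
    it is bounded by the L1 norm \<open>K\<close> of \<open>g\<close>, so |f| K dominates.\<close>
  define k where "k t \<omega> = cnj (f t) * (iexp (s * \<omega> * t) * fourier g (s * \<omega>))" for t \<omega>
  define K where "K = (LINT t|lborel. norm (g t))"
  have kn: "norm (k t \<omega>) \<le> norm (f t) * K" for t \<omega>
    unfolding k_def K_def by (auto simp: norm_mult intro!: mult_left_mono norm_fourier_le g)
  have km [measurable]: "(\<lambda>(t, \<omega>). k t \<omega>) \<in> borel_measurable (lborel \<Otimes>\<^sub>M std_normal_distribution)"
    unfolding k_def case_prod_beta by (rule mb) measurable
  have ki: "integrable (lborel \<Otimes>\<^sub>M std_normal_distribution) (\<lambda>(t, \<omega>). k t \<omega>)"
  proof -
    have k1: "integrable std_normal_distribution (\<lambda>\<omega>. k t \<omega>)" for t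
    proof (rule N.integrable_const_bound)
      show "AE \<omega> in std_normal_distribution. norm (k t \<omega>) \<le> norm (f t) * K" by (simp add: kn)
      show "(\<lambda>\<omega>. k t \<omega>) \<in> borel_measurable std_normal_distribution"
        unfolding k_def by measurable
    qed
    show ?thesis
    proof (rule P.Fubini_integrable)
      show "integrable lborel (\<lambda>u. LINT \<omega>|std_normal_distribution. norm (case (u, \<omega>) of (u, \<omega>) \<Rightarrow> k u \<omega>))"
      proof (rule Bochner_Integration.integrable_bound)
        show "integrable lborel (\<lambda>t. norm (f t) * K)" using f by simp
        have "(\<lambda>u. LINT \<omega>|std_normal_distribution. norm (k u \<omega>)) \<in> borel_measurable lborel"
          by measurable
        then show "(\<lambda>u. LINT \<omega>|std_normal_distribution. norm (case (u, \<omega>) of (u, \<omega>) \<Rightarrow> k u \<omega>)) \<in> borel_measurable lborel"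
          by simp
        have "(LINT \<omega>|std_normal_distribution. norm (k u \<omega>)) \<le> norm (f u) * K" for u
          using N.integral_le_const[of "\<lambda>\<omega>. norm (k u \<omega>)" "norm (f u) * K"] k1 kn by simp
        then show "AE u in lborel. norm (LINT \<omega>|std_normal_distribution. norm (case (u, \<omega>) of (u, \<omega>) \<Rightarrow> k u \<omega>)) \<le> norm (norm (f u) * K)"
          by (auto intro: order_trans[OF _ abs_ge_self])
      qed
    qed (use k1 in auto)
  qed
  have "cnj (fourier f (s * \<omega>)) * fourier g (s * \<omega>) = (LINT t|lborel. k t \<omega>)" for \<omega>
  proof -
    have "cnj (fourier f (s * \<omega>)) = (LINT t|lborel. cnj (iexp (- (s * \<omega> * t)) * f t))"
      unfolding fourier_def by (rule Bochner_Integration.integral_cnj[symmetric])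
    also have "\<dots> = (LINT t|lborel. iexp (s * \<omega> * t) * cnj (f t))"
      by (simp add: exp_cnj)
    finally show ?thesis
      by (simp only: k_def, subst integral_mult_left_zero[symmetric]) (simp add: mult_ac)
  qed
  then have "(LINT \<omega>|std_normal_distribution. cnj (fourier f (s * \<omega>)) * fourier g (s * \<omega>))
     = (LINT t|lborel. LINT \<omega>|std_normal_distribution. k t \<omega>)"
    using P.Fubini_integral[OF ki] by simp
  also have "\<dots> = (LINT t|lborel. cnj (f t) * (sqrt (2 * pi) / s * (LINT r|lborel. std_normal_density r * g (t + r / s))))"
    unfolding k_def by (simp only: integral_mult_right_zero inner)
  also have "\<dots> = (LINT t|lborel. (sqrt (2 * pi) / s) * (cnj (f t) * (LINT r|lborel. std_normal_density r * g (t + r / s))))"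
    by (intro Bochner_Integration.integral_cong) (auto simp: mult_ac)
  finally show ?thesis using s by simp
qed

text \<open>Averaging against a Gaussian of width 1 / Suc n recovers \<open>g\<close> at each point
  of continuity, boundedness of \<open>g\<close> providing the dominating function; the outer
  integral is dominated by |f| K. No integrability of the transforms is involved.
  \<open>Suc n\<close> keeps the width finite at n = 0.\<close>

lemma parseval_limit:
  fixes f g :: "real \<Rightarrow> complex"
  assumes f: "integrable lborel f" and g: "integrable lborel g"
    and K: "\<And>t. norm (g t) \<le> K" and cont: "AE t in lborel. isCont g t"
  shows "(\<lambda>n. Suc n / sqrt (2 * pi) * (LINT \<omega>|std_normal_distribution.
           cnj (fourier f (Suc n * \<omega>)) * fourier g (Suc n * \<omega>)))
         \<longlonglongrightarrow> (LINT t|lborel. cnj (f t) * g t)"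
proof -
  have [measurable]: "f \<in> borel_measurable borel" "g \<in> borel_measurable borel"
    using f g by auto
  have nd: "integrable lborel std_normal_density" "(LINT r|lborel. std_normal_density r) = 1"
    by simp_all
  define c where "c n t = (LINT r|lborel. std_normal_density r * g (t + r / Suc n))" for n t
  have nb: "norm (std_normal_density r * g t) \<le> std_normal_density r * K" for r t
    using K by (auto simp: norm_mult normal_density_nonneg intro!: mult_left_mono)
  have c: "(\<lambda>n. c n t) \<longlonglongrightarrow> g t" if "isCont g t" for t
  proof -
    have "(\<lambda>n. c n t) \<longlonglongrightarrow> (LINT r|lborel. std_normal_density r * g t)"
      unfolding c_def
    proof (rule integral_dominated_convergence)
      show "integrable lborel (\<lambda>r. std_normal_density r * K)" using nd(1) by simp
      show "AE r in lborel. (\<lambda>n. std_normal_density r * g (t + r / Suc n)) \<longlonglongrightarrow> std_normal_density r * g t"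
      proof (rule AE_I2)
        fix r :: real
        have "(\<lambda>n. t + r * inverse (real (Suc n))) \<longlonglongrightarrow> t + r * 0"
          by (intro tendsto_intros LIMSEQ_inverse_real_of_nat)
        then have "(\<lambda>n. g (t + r / Suc n)) \<longlonglongrightarrow> g t"
          unfolding divide_inverse mult_zero_right add_0_right
          by (rule isCont_tendsto_compose[OF that])
        then show "(\<lambda>n. std_normal_density r * g (t + r / Suc n)) \<longlonglongrightarrow> std_normal_density r * g t"
          by (rule tendsto_mult[OF tendsto_const])
      qed
      show "AE r in lborel. norm (std_normal_density r * g (t + r / Suc n)) \<le> std_normal_density r * K" for n
        using nb by auto
    qed measurable
    also have "(LINT r|lborel. std_normal_density r * g t) = g t"
      by simp
    finally show ?thesis .
  qed
  have cn: "norm (c n t) \<le> K" for n t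
  proof -
    have "norm (c n t) \<le> (LINT r|lborel. norm (std_normal_density r * g (t + r / Suc n)))"
      unfolding c_def by (rule integral_norm_bound)
    also have "\<dots> \<le> (LINT r|lborel. std_normal_density r * K)"
      using nd(1) nb by (intro integral_mono') (auto intro: order_trans[OF norm_ge_zero nb])
    finally show ?thesis by simp
  qed
  have [measurable]: "c n \<in> borel_measurable borel" for n
  proof -
    have "(\<lambda>t. LINT r|lborel. std_normal_density r * g (t + r / Suc n)) \<in> borel_measurable borel"
      by (rule lborel.borel_measurable_lebesgue_integral) measurable
    then show ?thesis by (simp add: c_def[abs_def])
  qed
  have "(\<lambda>n. LINT t|lborel. cnj (f t) * c n t) \<longlonglongrightarrow> (LINT t|lborel. cnj (f t) * g t)"
  proof (rule integral_dominated_convergence)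
    show "integrable lborel (\<lambda>t. norm (f t) * K)" using f by simp
    show "AE t in lborel. (\<lambda>n. cnj (f t) * c n t) \<longlonglongrightarrow> cnj (f t) * g t"
      using cont by eventually_elim (rule tendsto_mult[OF tendsto_const c])
    show "AE t in lborel. norm (cnj (f t) * c n t) \<le> norm (f t) * K" for n
      using cn by (auto simp: norm_mult intro!: mult_left_mono)
  qed measurable
  moreover have "(LINT t|lborel. cnj (f t) * c n t) = Suc n / sqrt (2 * pi) * (LINT \<omega>|std_normal_distribution.
           cnj (fourier f (Suc n * \<omega>)) * fourier g (Suc n * \<omega>))" for n
    using gaussian_average_fourier[OF f g, of "Suc n"] by (simp only: c_def of_nat_0_less_iff zero_less_Suc)
  ultimately show ?thesis by simp
qed

subsection \<open>Solutions of linear differential equations\<close>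

lemmas bounded_linear_matrix_vector = bounded_bilinear.bounded_linear_right[OF bounded_bilinear_matrix_vector]

lemma set_integrable_bounded_linear:
  assumes "bounded_linear T" "set_integrable M S f"
  shows "set_integrable M S (\<lambda>x. T (f x))"
proof -
  have "indicator S x *\<^sub>R T (f x) = T (indicator S x *\<^sub>R f x)" for x
    by (simp add: linear_scale[OF bounded_linear.linear[OF assms(1)]])
  then show ?thesis
    using integrable_bounded_linear[OF assms(1)] assms(2) by (simp add: set_integrable_def)
qed

lemma L2_Rplus_imp_locally_integrable:
  assumes "u \<in> L2_Rplus" "0 \<le> a"
  shows "set_integrable lebesgue {a..b} u"
proof (rule set_integrable_bound)
  have m: "set_borel_measurable lebesgue {0..} u" and i: "set_integrable lebesgue {0..} (\<lambda>t. (norm (u t))\<^sup>2)"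
    using assms by (auto simp: L2_Rplus_def)
  have "set_integrable lebesgue {a..b} (\<lambda>t. (norm (u t))\<^sup>2)"
    by (rule set_integrable_subset[OF i]) (use assms in auto)
  moreover have "set_integrable lebesgue {a..b} (\<lambda>t. 1::real)"
    by (intro absolutely_integrable_continuous_real continuous_intros)
  ultimately show "set_integrable lebesgue {a..b} (\<lambda>t. 1 + (norm (u t))\<^sup>2)"
    by simp
  show "set_borel_measurable lebesgue {a..b} u"
    by (rule set_borel_measurable_subset[OF m]) (use assms in auto)
  have "x \<le> 1 + x\<^sup>2" for x :: real
    using zero_le_power2[of "x - 1/2"] by (simp add: power2_eq_square algebra_simps)
  then show "AE x in lebesgue. x \<in> {a..b} \<longrightarrow> norm (u x) \<le> norm (1 + (norm (u x))\<^sup>2)"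
    by (auto intro: order_trans[OF _ abs_ge_self])
qed

lemma matrix_minus_right: "A ** (- B) = - (A ** (B :: 'a::comm_ring_1^'n^'m))"
  by (simp add: vec_eq_iff matrix_matrix_mult_def sum_negf)

lemma matrix_minus_vector: "(- A) *v x = - (A *v (x :: 'a::comm_ring_1^'n))"
  by (simp add: vec_eq_iff matrix_vector_mult_def sum_negf)

text \<open>The exponential exp (t A), described by its initial value problem. It is instantiated
  both with \<open>A\<close> and with the closed loop matrix \<open>A + B ** F\<close>.\<close>

locale matrix_flow =
  fixes A :: "complex^'n^'n" and E :: "real \<Rightarrow> complex^'n^'n"
  assumes E_0: "E 0 = mat 1"
    and E_commute: "A ** E t = E t ** A"
    and E_deriv: "(E has_vector_derivative (A ** E t)) (at t)"
begin

lemma continuous_on_E: "continuous_on S E"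
  by (meson E_deriv continuous_at_imp_continuous_on has_vector_derivative_continuous)

lemma continuous_on_E_comp [continuous_intros]: "continuous_on S f \<Longrightarrow> continuous_on S (\<lambda>t. E (f t))"
  by (rule continuous_on_compose2[OF continuous_on_E[of UNIV]]) auto

lemma E_deriv_minus: "((\<lambda>t. E (- t)) has_vector_derivative (- (A ** E (- t)))) (at t within S)"
proof -
  have "((E \<circ> uminus) has_vector_derivative ((-1) *\<^sub>R (A ** E (- t)))) (at t within S)"
    by (intro vector_diff_chain_within has_vector_derivative_minus has_vector_derivative_id
        has_vector_derivative_at_within[OF E_deriv])
  then show ?thesis by (simp add: o_def)
qed

lemma E_inverse: "E t ** E (- t) = mat 1"
proof -
  have d: "((\<lambda>t. E t ** E (- t)) has_vector_derivative 0) (at t within UNIV)" for t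
    using matrix_mult_has_vector_derivative[OF E_deriv E_deriv_minus, of t]
    by (simp add: E_commute[of t] matrix_mul_assoc matrix_minus_right)
  obtain c where c: "\<And>t. E t ** E (- t) = c"
    by (rule has_vector_derivative_zero_constant[OF convex_UNIV d]) (rule that, simp)
  from c[of 0] have "c = mat 1" by (simp add: E_0)
  with c show ?thesis by simp
qed

lemma E_vector_deriv: "((\<lambda>t. E t *v x) has_vector_derivative (A *v (E t *v x))) (at t within S)"
  using matrix_vector_has_vector_derivative[OF has_vector_derivative_at_within[OF E_deriv] has_vector_derivative_const]
  by (simp add: matrix_vector_mul_assoc)

definition response :: "(real \<Rightarrow> complex^'n) \<Rightarrow> real \<Rightarrow> complex^'n" where
  "response h t = h t + E t *v integral {0..t} (\<lambda>s. E (- s) *v (A *v h s))"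

text \<open>Subtracting the primitive \<open>h\<close> of the forcing term from the solution leaves an equation with
  the continuous forcing \<open>A h\<close>, so variation of constants applies although \<open>b\<close> is only integrable.\<close>

lemma response_solution:
  assumes b: "\<And>t. 0 \<le> t \<Longrightarrow> set_integrable lebesgue {0..t} b"
    and h: "\<And>t. 0 \<le> t \<Longrightarrow> h t = integral {0..t} b" and t: "0 \<le> t"
  shows "continuous_on {0..t} h" "continuous_on {0..t} (response h)"
    "set_integrable lebesgue {0..t} (\<lambda>s. A *v response h s + b s)"
    "response h t = (LINT s:{0..t}|lebesgue. A *v response h s + b s)"
proof -
  have bi: "b integrable_on {0..t}" using b[OF t] set_lebesgue_integral_eq_integral(1) by blast
  have "continuous_on {0..t} (\<lambda>t. integral {0..t} b)"
    by (rule indefinite_integral_continuous_1[OF bi])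
  then show hc: "continuous_on {0..t} h"
    by (rule continuous_on_eq) (simp add: h)
  define k where "k s = E (- s) *v (A *v h s)" for s
  define g where "g s = integral {0..s} k" for s
  have kc: "continuous_on {0..t} k" unfolding k_def by (intro continuous_intros hc)
  have g': "(g has_vector_derivative k s) (at s within {0..t})" if "s \<in> {0..t}" for s
    unfolding g_def by (rule integral_has_vector_derivative[OF kc that])
  define y where "y s = E s *v g s" for s
  have r: "response h s = h s + y s" for s by (simp add: response_def y_def g_def k_def[abs_def])
  have y': "(y has_vector_derivative (A *v y s + A *v h s)) (at s within {0..t})" if "s \<in> {0..t}" for s
  proof -
    have "E s *v k s = A *v h s"
      by (simp add: k_def matrix_vector_mul_assoc matrix_mul_assoc E_inverse)
    then show ?thesis
      using matrix_vector_has_vector_derivative[OF has_vector_derivative_at_within[OF E_deriv] g'[OF that]]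
      by (simp add: y_def[abs_def] matrix_vector_mul_assoc add.commute)
  qed
  have yc: "continuous_on {0..t} y"
    by (rule continuous_on_vector_derivative[OF y'])
  show rc: "continuous_on {0..t} (response h)"
    unfolding r[abs_def] by (intro continuous_intros hc yc)
  show i: "set_integrable lebesgue {0..t} (\<lambda>s. A *v response h s + b s)"
    by (intro set_integral_add(1) b t absolutely_integrable_continuous_real continuous_intros rc)
  have y_int: "((\<lambda>s. A *v y s + A *v h s) has_integral (y t - y 0)) {0..t}"
    by (rule fundamental_theorem_of_calculus) (use t y' in auto)
  have "y 0 = 0" by (simp add: y_def g_def)
  have "(b has_integral h t) {0..t}"
    using bi h[OF t] by (simp add: has_integral_integrable_integral)
  from has_integral_add[OF y_int this]
  have "((\<lambda>s. A *v response h s + b s) has_integral response h t) {0..t}"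
    by (simp add: r matrix_vector_right_distrib add.commute \<open>y 0 = 0\<close>)
  then show "response h t = (LINT s:{0..t}|lebesgue. A *v response h s + b s)"
    using set_lebesgue_integral_eq_integral(2)[OF i] by (simp add: integral_unique)
qed

text \<open>The integral equation upgrades \<open>y\<close> twice: an indefinite integral is
  continuous, and then it is differentiable. After that E (-s) y(s) has derivative zero, and it
  vanishes at s = 0.\<close>

lemma homogeneous_unique:
  fixes y :: "real \<Rightarrow> complex^'n"
  assumes i: "\<And>t. 0 \<le> t \<Longrightarrow> set_integrable lebesgue {0..t} (\<lambda>s. A *v y s)"
    and y: "\<And>t. 0 \<le> t \<Longrightarrow> y t = (LINT s:{0..t}|lebesgue. A *v y s)" and t: "0 \<le> t"
  shows "y t = 0"
proof -
  have y1: "y s = integral {0..s} (\<lambda>s. A *v y s)" if "0 \<le> s" for s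
    using y[OF that] set_lebesgue_integral_eq_integral(2)[OF i[OF that]] by simp
  have "(\<lambda>s. A *v y s) integrable_on {0..t}" using i[OF t] set_lebesgue_integral_eq_integral(1) by blast
  then have "continuous_on {0..t} (\<lambda>s. integral {0..s} (\<lambda>s. A *v y s))"
    by (rule indefinite_integral_continuous_1)
  then have yc: "continuous_on {0..t} y"
    by (rule continuous_on_eq) (simp add: y1[symmetric])
  have y': "(y has_vector_derivative (A *v y s)) (at s within {0..t})" if "s \<in> {0..t}" for s
  proof (rule has_vector_derivative_transform[OF that])
    show "((\<lambda>s. integral {0..s} (\<lambda>s. A *v y s)) has_vector_derivative (A *v y s)) (at s within {0..t})"
      by (intro integral_has_vector_derivative continuous_intros yc that)
  qed (simp add: y1[symmetric])
  have d: "((\<lambda>s. E (- s) *v y s) has_vector_derivative 0) (at s within {0..t})" if "s \<in> {0..t}" for s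
  proof -
    have "E (- s) *v (A *v y s) + (- (A ** E (- s))) *v y s = 0"
      by (simp add: matrix_vector_mul_assoc E_commute matrix_minus_vector)
    then show ?thesis
      using matrix_vector_has_vector_derivative[OF E_deriv_minus y'[OF that]] by simp
  qed
  obtain c where c: "\<And>s. s \<in> {0..t} \<Longrightarrow> E (- s) *v y s = c"
    by (rule has_vector_derivative_zero_constant[OF convex_real_interval(5) d]) (assumption, rule that)
  from y[of 0] have "y 0 = 0"
    using y1[of 0] by simp
  then have "E (- t) *v y t = 0" using c[of t] c[of 0] t by simp
  then have "E t *v (E (- t) *v y t) = 0" by simp
  then show ?thesis by (simp add: matrix_vector_mul_assoc E_inverse)
qed

lemma is_solution_unique:
  assumes "is_solution A B x0 u x1" "is_solution A B x0 u x2" "0 \<le> t"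
  shows "x1 t = x2 t"
proof -
  define y where "y s = x1 s - x2 s" for s
  have s1: "set_integrable lebesgue {0..t} (\<lambda>s. A *v x1 s + B *v u s)"
      "x1 t = x0 + (LINT s:{0..t}|lebesgue. A *v x1 s + B *v u s)"
    and s2: "set_integrable lebesgue {0..t} (\<lambda>s. A *v x2 s + B *v u s)"
      "x2 t = x0 + (LINT s:{0..t}|lebesgue. A *v x2 s + B *v u s)" if "0 \<le> t" for t
    using assms that by (auto simp: is_solution_def)
  have eq: "A *v y s = (A *v x1 s + B *v u s) - (A *v x2 s + B *v u s)" for s
    by (simp add: y_def matrix_vector_mult_diff_distrib)
  have "y t = 0"
  proof (rule homogeneous_unique[OF _ _ assms(3)])
    fix t :: real assume t: "0 \<le> t"
    show "set_integrable lebesgue {0..t} (\<lambda>s. A *v y s)"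
      unfolding eq using s1(1)[OF t] s2(1)[OF t] by (rule set_integral_diff(1))
    have "(LINT s:{0..t}|lebesgue. A *v y s) = (LINT s:{0..t}|lebesgue. A *v x1 s + B *v u s) -
       (LINT s:{0..t}|lebesgue. A *v x2 s + B *v u s)"
      unfolding eq using s1(1)[OF t] s2(1)[OF t] by (rule set_integral_diff(2))
    then show "y t = (LINT s:{0..t}|lebesgue. A *v y s)"
      using s1(2)[OF t] s2(2)[OF t] by (simp add: y_def)
  qed
  then show ?thesis by (simp add: y_def)
qed

text \<open>Uniqueness makes the choice in \<open>state\<close> harmless for t \<ge> 0: exhibiting
  any solution identifies the state.\<close>

lemma state_eq:
  assumes "is_solution A B x0 u x" "0 \<le> t"
  shows "state A B x0 u t = x t"
  unfolding state_def
  by (rule is_solution_unique[OF someI[of "is_solution A B x0 u", OF assms(1)] assms])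

end

lemma matrix_flow_exists: "\<exists>E. matrix_flow A E"
  by (rule matrix_exponential[of A]) (auto simp: matrix_flow_def)

text \<open>The finite exceptional set admits the corner of the state at the switching time;
  continuity there suffices for the fundamental theorem of calculus.\<close>

lemma is_solution_piecewise:
  assumes c: "continuous_on {0..} x" and S: "finite S"
    and d: "\<And>t. 0 < t \<Longrightarrow> t \<notin> S \<Longrightarrow> (x has_vector_derivative (A *v x t + B *v u t)) (at t)"
    and u: "\<And>t. 0 \<le> t \<Longrightarrow> set_integrable lebesgue {0..t} u"
  shows "is_solution A B (x 0) u x"
  unfolding is_solution_def
proof (intro allI impI conjI)
  fix t :: real assume t: "0 \<le> t"
  have c': "continuous_on {0..t} x" by (rule continuous_on_subset[OF c]) auto
  show i: "set_integrable lebesgue {0..t} (\<lambda>s. A *v x s + B *v u s)"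
    by (intro set_integral_add(1) set_integrable_bounded_linear[OF bounded_linear_matrix_vector u[OF t]]
        absolutely_integrable_continuous_real continuous_intros c')
  have "((\<lambda>s. A *v x s + B *v u s) has_integral (x t - x 0)) {0..t}"
    by (rule fundamental_theorem_of_calculus_interior_strong[OF S t _ c']) (use d in auto)
  then show "x t = x 0 + (LINT s:{0..t}|lebesgue. A *v x s + B *v u s)"
    using set_lebesgue_integral_eq_integral(2)[OF i] by (simp add: integral_unique)
qed

subsection \<open>Hermitian forms in the frequency domain\<close>

text \<open>The polarized form of \<open>cquad\<close>. It is bounded bilinear over the reals, which
  gives continuity, norm bounds and expansion of differences.\<close>

definition sesq :: "complex^'p^'p \<Rightarrow> complex^'p \<Rightarrow> complex^'p \<Rightarrow> complex" where
  "sesq M a b = (\<Sum>i\<in>UNIV. cnj (a $ i) * (M *v b) $ i)"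

lemma cquad_eq_sesq: "cquad M v = sesq M v v"
  by (simp add: cquad_def sesq_def)

lemma bounded_bilinear_sesq: "bounded_bilinear (sesq M)"
  unfolding bilinear_conv_bounded_bilinear[symmetric] bilinear_def
  by (auto intro!: linearI simp: sesq_def algebra_simps sum.distrib scaleR_sum_right
      matrix_vector_right_distrib bounded_linear.linear[OF bounded_linear_matrix_vector] linear_scale)

lemma sesq_scale: "sesq M (c *s a) (d *s b) = cnj c * d * sesq M a b"
  by (simp add: sesq_def vector_scalar_commute sum_distrib_left mult_ac)

text \<open>The entrywise form lets scalar facts about pairs of components (integrability, limits,
  transforms) act on the quadratic form.\<close>

lemma cquad_expand: "cquad M v = (\<Sum>i\<in>UNIV. \<Sum>j\<in>UNIV. M $ i $ j * (cnj (v $ i) * v $ j))"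
  by (simp add: cquad_def matrix_vector_mult_def sum_distrib_left mult_ac)

lemma conj_transpose_vector_nth: "(conj_transpose G *v x) $ i = (\<Sum>k\<in>UNIV. cnj (G $ k $ i) * x $ k)"
  by (simp add: matrix_vector_mult_def conj_transpose_def)

lemma sesq_adjoint: "sesq (conj_transpose G ** N) v w = (\<Sum>k\<in>UNIV. cnj ((G *v v) $ k) * (N *v w) $ k)"
proof -
  have "sesq (conj_transpose G ** N) v w = (\<Sum>i\<in>UNIV. \<Sum>k\<in>UNIV. cnj (v $ i) * (cnj (G $ k $ i) * (N *v w) $ k))"
    by (simp add: sesq_def matrix_vector_mul_assoc[symmetric] conj_transpose_vector_nth sum_distrib_left)
  also have "\<dots> = (\<Sum>k\<in>UNIV. \<Sum>i\<in>UNIV. cnj (v $ i) * (cnj (G $ k $ i) * (N *v w) $ k))"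
    by (rule sum.swap)
  also have "\<dots> = (\<Sum>k\<in>UNIV. cnj ((G *v v) $ k) * (N *v w) $ k)"
    by (simp add: matrix_vector_mult_def[of G] sum_distrib_left mult_ac)
  finally show ?thesis .
qed

lemma cquad_congruence: "cquad (conj_transpose G ** M ** G) v = cquad M (G *v v)"
  by (simp add: cquad_eq_sesq matrix_mul_assoc[symmetric] sesq_adjoint)
     (simp add: sesq_def matrix_vector_mul_assoc)

lemma conj_transpose_mult: "conj_transpose (X ** Y) = conj_transpose Y ** conj_transpose X"
  by (simp add: vec_eq_iff conj_transpose_def matrix_matrix_mult_def mult.commute)

lemma conj_transpose_conj_transpose [simp]: "conj_transpose (conj_transpose X) = X"
  by (simp add: vec_eq_iff conj_transpose_def)

lemma Im_cquad_hermitian: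
  assumes "conj_transpose M = M"
  shows "Im (cquad M v) = 0"
proof -
  have M: "cnj (M $ i $ j) = M $ j $ i" for i j
    using assms by (auto simp: vec_eq_iff conj_transpose_def)
  have "cnj (cquad M v) = (\<Sum>i\<in>UNIV. \<Sum>j\<in>UNIV. M $ j $ i * (cnj (v $ j) * v $ i))"
    by (simp add: cquad_expand M mult_ac)
  also have "\<dots> = cquad M v"
    unfolding cquad_expand by (rule sum.swap)
  finally show ?thesis by (simp add: complex_eq_iff)
qed

lemma continuous_on_cquad [continuous_intros]:
  "continuous_on S f \<Longrightarrow> continuous_on S (\<lambda>x. cquad M (f x))"
  unfolding cquad_eq_sesq by (intro bounded_bilinear.continuous_on[OF bounded_bilinear_sesq])

lemma cquad_bound:
  obtains K where "K > 0" "\<And>v. norm (cquad M v) \<le> K * (norm v)\<^sup>2"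
proof -
  obtain K where "K > 0" "\<And>a b. norm (sesq M a b) \<le> norm a * norm b * K"
    using bounded_bilinear.pos_bounded[OF bounded_bilinear_sesq[of M]] by blast
  then show thesis
    by (intro that[of K]) (auto simp: cquad_eq_sesq power2_eq_square mult_ac)
qed

section \<open>Stacked state and input vectors\<close>

lemma vstack_Inl [simp]: "vstack x y $ Inl i = x $ i"
  and vstack_Inr [simp]: "vstack x y $ Inr j = y $ j"
  by (simp_all add: vstack_def)

lemma sum_UNIV_Plus: "(\<Sum>k\<in>(UNIV :: ('a::finite + 'b::finite) set). f k) = (\<Sum>i\<in>UNIV. f (Inl i)) + (\<Sum>j\<in>UNIV. f (Inr j))"
  using sum.Plus[of "UNIV :: 'a set" "UNIV :: 'b set" f] by (simp add: UNIV_Plus_UNIV)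

lemma all_Plus: "(\<forall>k. P k) \<longleftrightarrow> (\<forall>i. P (Inl i)) \<and> (\<forall>j. P (Inr j))"
  by (metis obj_sumE)

lemma vstack_mult_vector: "vstack P Q *v w = vstack (P *v w) (Q *v w)"
  by (simp add: vec_eq_iff all_Plus matrix_vector_mult_def)

lemma vstack_scale: "vstack (c *s x) (c *s y) = c *s vstack x y"
  by (simp add: vec_eq_iff all_Plus)

lemma vstack_diff: "vstack (x - x') (y - y') = vstack x y - vstack x' y'"
  by (simp add: vec_eq_iff all_Plus)

lemma norm_vstack: "(norm (vstack x y))\<^sup>2 = (norm x)\<^sup>2 + (norm y)\<^sup>2"
  by (simp add: norm_vec_def L2_set_def sum_UNIV_Plus sum_nonneg)

lemma norm_vstack_le: "norm (vstack x y) \<le> norm x + norm y"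
  by (rule power2_le_imp_le) (auto simp: norm_vstack power2_sum)

lemma bounded_linear_vstack: "bounded_linear (\<lambda>p. vstack (fst p :: complex^'n::finite) (snd p :: complex^'m::finite))"
  by (intro linear_conv_bounded_linear[THEN iffD1] linearI) (auto simp: vec_eq_iff all_Plus)

lemma continuous_on_vstack [continuous_intros]:
  fixes f :: "'z::topological_space \<Rightarrow> complex^'n" and g :: "'z \<Rightarrow> complex^'m"
  assumes "continuous_on S f" "continuous_on S g"
  shows "continuous_on S (\<lambda>x. vstack (f x) (g x))"
  using bounded_linear.continuous_on[OF bounded_linear_vstack continuous_on_Pair[OF assms]] by simp

text \<open>The Gaussian averages of the form over frequency are nonnegative, since finitely many
  exceptional frequencies have measure zero after any rescaling. \<open>parseval_limit\<close>,
  applied to each pair of components, identifies their limit with the time integral.\<close>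

lemma fourier_nonneg_imp_nonneg:
  fixes z :: "real \<Rightarrow> complex^'k"
  assumes int: "\<And>i. integrable lborel (\<lambda>t. z t $ i)" and K: "\<And>t. norm (z t) \<le> K"
    and cont: "AE t in lborel. isCont z t"
    and S: "finite S" and pos: "\<And>\<omega>. \<omega> \<notin> S \<Longrightarrow> 0 \<le> Re (cquad M (\<chi> i. fourier (\<lambda>t. z t $ i) \<omega>))"
  shows "0 \<le> Re (LINT t|lborel. cquad M (z t))"
proof -
  define fz where "fz \<omega> = (\<chi> i. fourier (\<lambda>t. z t $ i) \<omega>)" for \<omega>
  define c where "c n = real (Suc n) / sqrt (2 * pi)" for n
  define a where "a n = complex_of_real (c n) * (LINT \<omega>|std_normal_distribution. cquad M (fz (Suc n * \<omega>)))" for n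
  have Ki: "norm (z t $ i) \<le> K" for t i
    by (rule order_trans[OF Finite_Cartesian_Product.norm_nth_le K])
  have fi: "integrable std_normal_distribution (\<lambda>\<omega>. cnj (fz (s * \<omega>) $ i) * fz (s * \<omega>) $ j)" for s i j
    using integrable_fourier_product[OF int int] by (simp add: fz_def)
  have zi: "integrable lborel (\<lambda>t. cnj (z t $ i) * z t $ j)" for i j
  proof (rule Bochner_Integration.integrable_bound)
    show "integrable lborel (\<lambda>t. z t $ i * of_real K)" using int by simp
    show "(\<lambda>t. cnj (z t $ i) * z t $ j) \<in> borel_measurable lborel"
      using int[of i] int[of j] by measurable
    show "AE t in lborel. norm (cnj (z t $ i) * z t $ j) \<le> norm (z t $ i * of_real K)"
    proof (rule AE_I2)
      fix t
      have "norm (z t $ j) \<le> \<bar>K\<bar>" using Ki[of t j] by linarith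
      then show "norm (cnj (z t $ i) * z t $ j) \<le> norm (z t $ i * of_real K)"
        by (simp add: norm_mult mult_left_mono)
    qed
  qed
  have "a n = (\<Sum>i\<in>UNIV. \<Sum>j\<in>UNIV. M $ i $ j * (complex_of_real (c n) *
      (LINT \<omega>|std_normal_distribution. cnj (fz (Suc n * \<omega>) $ i) * fz (Suc n * \<omega>) $ j)))" for n
  proof -
    have "(LINT \<omega>|std_normal_distribution. cquad M (fz (Suc n * \<omega>))) = (\<Sum>i\<in>UNIV. \<Sum>j\<in>UNIV. M $ i $ j *
      (LINT \<omega>|std_normal_distribution. cnj (fz (Suc n * \<omega>) $ i) * fz (Suc n * \<omega>) $ j))"
      unfolding cquad_expand
      by (subst Bochner_Integration.integral_sum, intro Bochner_Integration.integrable_sum integrable_mult_right fi,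
          subst Bochner_Integration.integral_sum, intro integrable_mult_right fi) simp
    then show ?thesis by (simp add: a_def sum_distrib_left mult_ac)
  qed
  moreover have "(\<lambda>n. \<Sum>i\<in>UNIV. \<Sum>j\<in>UNIV. M $ i $ j * (complex_of_real (c n) *
      (LINT \<omega>|std_normal_distribution. cnj (fz (Suc n * \<omega>) $ i) * fz (Suc n * \<omega>) $ j)))
    \<longlonglongrightarrow> (\<Sum>i\<in>UNIV. \<Sum>j\<in>UNIV. M $ i $ j * (LINT t|lborel. cnj (z t $ i) * z t $ j))"
  proof (intro tendsto_sum tendsto_mult[OF tendsto_const])
    fix i j
    have "AE t in lborel. isCont (\<lambda>t. z t $ j) t"
      using cont by eventually_elim simp
    from parseval_limit[OF int[of i] int[of j] Ki this]
    show "(\<lambda>n. complex_of_real (c n) *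
      (LINT \<omega>|std_normal_distribution. cnj (fz (Suc n * \<omega>) $ i) * fz (Suc n * \<omega>) $ j))
      \<longlonglongrightarrow> (LINT t|lborel. cnj (z t $ i) * z t $ j)"
      by (simp add: c_def fz_def)
  qed
  moreover have "(\<Sum>i\<in>UNIV. \<Sum>j\<in>UNIV. M $ i $ j * (LINT t|lborel. cnj (z t $ i) * z t $ j))
     = (LINT t|lborel. cquad M (z t))"
    unfolding cquad_expand
    by (subst Bochner_Integration.integral_sum, intro Bochner_Integration.integrable_sum integrable_mult_right zi,
        subst Bochner_Integration.integral_sum, intro integrable_mult_right zi) simp
  ultimately have "(\<lambda>n. a n) \<longlonglongrightarrow> (LINT t|lborel. cquad M (z t))"
    by (simp only:)
  then have lim: "(\<lambda>n. Re (a n)) \<longlonglongrightarrow> Re (LINT t|lborel. cquad M (z t))"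
    by (rule tendsto_Re)
  have "0 \<le> Re (a n)" for n
  proof -
    have i: "integrable std_normal_distribution (\<lambda>\<omega>. cquad M (fz (Suc n * \<omega>)))"
      unfolding cquad_expand by (intro Bochner_Integration.integrable_sum integrable_mult_right fi)
    have "finite ((\<lambda>\<omega>. \<omega> / Suc n) ` S)" using S by simp
    then have "AE \<omega> in lborel. \<omega> \<notin> (\<lambda>\<omega>. \<omega> / Suc n) ` S"
      by (intro AE_not_in finite_imp_null_set_lborel)
    then have "AE \<omega> in lborel. 0 \<le> Re (cquad M (fz (Suc n * \<omega>)))"
    proof eventually_elim
      case (elim \<omega>)
      have "Suc n * \<omega> \<notin> S"
      proof
        assume "Suc n * \<omega> \<in> S"
        then have "(Suc n * \<omega>) / Suc n \<in> (\<lambda>\<omega>. \<omega> / Suc n) ` S" by (rule imageI)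
        then show False using elim by simp
      qed
      then show ?case using pos by (simp add: fz_def)
    qed
    then have "AE \<omega> in std_normal_distribution. 0 \<le> Re (cquad M (fz (Suc n * \<omega>)))"
      by (subst AE_density) auto
    then have "0 \<le> (LINT \<omega>|std_normal_distribution. Re (cquad M (fz (Suc n * \<omega>))))"
      by (rule integral_nonneg_AE)
    also have "\<dots> = Re (LINT \<omega>|std_normal_distribution. cquad M (fz (Suc n * \<omega>)))"
      using i by (rule integral_Re)
    finally show ?thesis
      by (simp add: a_def c_def)
  qed
  then show ?thesis
    using lim by (intro LIMSEQ_le_const[OF lim]) auto
qed

text \<open>Integrate the derivative \<open>k\<close> of e f over [0, b]: the boundary term at 0
  vanishes by \<open>f0\<close>, the one at b in the limit. Vanishing at negative times turns the
  half-line integrals into transforms.\<close>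

lemma fourier_deriv:
  fixes f g :: "real \<Rightarrow> complex"
  assumes f: "integrable lborel f" and g: "integrable lborel g"
    and neg: "\<And>t. t < 0 \<Longrightarrow> f t = 0" "\<And>t. t < 0 \<Longrightarrow> g t = 0"
    and c: "continuous_on {0..} f" and f0: "f 0 = 0" and lim: "(f \<longlongrightarrow> 0) at_top"
    and S: "finite S" and d: "\<And>t. 0 < t \<Longrightarrow> t \<notin> S \<Longrightarrow> (f has_vector_derivative g t) (at t)"
  shows "fourier g \<omega> = \<i> * \<omega> * fourier f \<omega>"
proof -
  define e where "e t = iexp (- (\<omega> * t))" for t :: real
  have e': "(e has_vector_derivative (- (\<i> * \<omega>) * e t)) (at t)" for t
  proof -
    have "e = (\<lambda>t. exp (- (\<i> * \<omega>) * complex_of_real t))"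
      by (simp add: e_def fun_eq_iff mult_ac)
    then show ?thesis
      by (simp only:) (rule has_vector_derivative_real_field, auto intro!: derivative_eq_intros)
  qed
  have ec: "continuous_on T e" for T unfolding e_def by (intro continuous_intros)
  have en: "norm (e t) = 1" for t by (simp add: e_def)
  define k where "k t = e t * g t - \<i> * \<omega> * (e t * f t)" for t
  have ef: "integrable lborel (\<lambda>t. e t * f t)" "integrable lborel (\<lambda>t. e t * g t)"
    unfolding e_def using integrable_iexp_mult f g by auto
  have ki: "integrable lborel k" unfolding k_def using ef by simp
  have kS: "set_integrable lborel T k" if "T \<in> sets lborel" for T
    using ki that unfolding set_integrable_def by (intro integrable_mult_indicator)
  have "((\<lambda>b. LINT t:{0..b}|lborel. k t) \<longlongrightarrow> (LINT t:{0..}|lborel. k t)) at_top"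
    by (intro tendsto_set_lebesgue_integral_at_top kS) auto
  moreover have "((\<lambda>b. LINT t:{0..b}|lborel. k t) \<longlongrightarrow> 0) at_top"
  proof (rule Lim_transform_eventually)
    show "((\<lambda>b. e b * f b) \<longlongrightarrow> 0) at_top"
      by (rule tendsto_norm_zero_cancel) (use tendsto_norm_zero[OF lim] in \<open>simp add: norm_mult en\<close>)
    show "eventually (\<lambda>b. e b * f b = (LINT t:{0..b}|lborel. k t)) at_top"
      using eventually_ge_at_top[of 0]
    proof eventually_elim
      case (elim b)
      have "(k has_integral (e b * f b - e 0 * f 0)) {0..b}"
      proof (rule fundamental_theorem_of_calculus_interior_strong[OF S elim])
        show "continuous_on {0..b} (\<lambda>t. e t * f t)"
          by (intro continuous_intros ec continuous_on_subset[OF c]) auto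
        fix t assume t: "t \<in> {0<..<b} - S"
        then have "((\<lambda>t. e t * f t) has_vector_derivative (e t * g t + (- (\<i> * \<omega>) * e t) * f t)) (at t)"
          by (intro has_vector_derivative_mult e' d) auto
        then show "((\<lambda>t. e t * f t) has_vector_derivative k t) (at t)"
          by (simp add: k_def algebra_simps)
      qed
      then show ?case
        using set_borel_integral_eq_integral(2)[OF kS, of "{0..b}"] by (simp add: f0 integral_unique)
    qed
  qed
  ultimately have "(LINT t:{0..}|lborel. k t) = 0"
    by (rule tendsto_unique[rotated]) simp
  moreover have "indicator {0..} t *\<^sub>R k t = k t" for t
    by (cases "t < 0") (auto simp: k_def neg)
  ultimately have "0 = (LINT t|lborel. k t)"
    by (simp add: set_lebesgue_integral_def)
  also have "\<dots> = (LINT t|lborel. e t * g t) - \<i> * \<omega> * (LINT t|lborel. e t * f t)"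
    unfolding k_def using ef by simp
  finally show ?thesis by (simp add: fourier_def e_def)
qed

subsection \<open>Continuation by a stabilizing feedback\<close>

lemma matrix_inv_resolvent:
  assumes "z \<notin> spectrum A"
  shows "matrix_inv (mat z - A) ** (mat z - A) = mat 1"
    "(mat z - A) ** matrix_inv (mat z - A) = mat 1"
proof -
  have "\<forall>v. (mat z - A) *v v = 0 \<longrightarrow> v = 0"
    using assms by (auto simp: spectrum_def matrix_vector_mult_diff_rdistrib mat_mult_vector)
  then have "invertible (mat z - A)"
    using matrix_left_invertible_ker[of "mat z - A"] invertible_left_inverse by blast
  then have "\<exists>X. (mat z - A) ** X = mat 1 \<and> X ** (mat z - A) = mat 1"
    by (simp add: invertible_def)
  from someI_ex[OF this] show "matrix_inv (mat z - A) ** (mat z - A) = mat 1"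
    "(mat z - A) ** matrix_inv (mat z - A) = mat 1"
    by (auto simp: matrix_inv_def)
qed

lemma popov_hermitian:
  assumes "conj_transpose M = M"
  shows "conj_transpose (popov A B M \<omega>) = popov A B M \<omega>"
  by (simp add: popov_def Let_def conj_transpose_mult assms matrix_mul_assoc)

text \<open>Off the spectrum the resolvent equation has only one solution, so its use can be
  replaced by the equation itself. One direction meets that equation in the Fourier transforms, the
  other in the amplitude of a harmonic response.\<close>

lemma cquad_popov:
  assumes z: "\<i> * of_real \<omega> \<notin> spectrum A" and x: "(\<i> * of_real \<omega>) *s x = A *v x + B *v w"
  shows "cquad (popov A B M \<omega>) w = cquad M (vstack x w)"
proof -
  let ?R = "mat (\<i> * of_real \<omega>) - A"
  have "?R *v x = B *v w"
    by (simp add: matrix_vector_mult_diff_rdistrib mat_mult_vector x)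
  then have "matrix_inv ?R *v (?R *v x) = matrix_inv ?R *v (B *v w)"
    by simp
  then have "x = (matrix_inv ?R ** B) *v w"
    using matrix_inv_resolvent(1)[OF z] by (simp add: matrix_vector_mul_assoc)
  then show ?thesis
    by (simp add: popov_def Let_def cquad_congruence vstack_mult_vector)
qed

section \<open>Exponentially decaying functions on the half-line\<close>

lemma exp_decay_set_integrable:
  assumes "c > 0"
  shows "set_integrable lebesgue {a..} (\<lambda>t. exp (- c * t) :: real)"
  by (rule nonnegative_absolutely_integrable_1)
     (use has_integral_exp_minus_to_infinity[OF assms] in \<open>auto simp: integrable_on_def\<close>)

lemma exp_decay_imp_set_integrable:
  fixes f :: "real \<Rightarrow> 'b::{banach, second_countable_topology}"
  assumes "c > 0" and f: "f \<in> borel_measurable borel"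
    and b: "\<And>t. 0 \<le> t \<Longrightarrow> norm (f t) \<le> C * exp (- c * t)"
  shows "set_integrable lebesgue {0..} f" "integrable lborel (\<lambda>t. if t < 0 then 0 else f t)"
proof -
  show s: "set_integrable lebesgue {0..} f"
  proof (rule set_integrable_bound)
    show "set_integrable lebesgue {0..} (\<lambda>t. C * exp (- c * t))"
      using exp_decay_set_integrable[OF assms(1)] by simp
    show "set_borel_measurable lebesgue {0..} f"
      unfolding set_borel_measurable_def using f
      by (intro borel_measurable_scaleR borel_measurable_indicator measurable_completion) auto
    show "AE t in lebesgue. t \<in> {0..} \<longrightarrow> norm (f t) \<le> norm (C * exp (- c * t))"
    proof (intro AE_I2 impI)
      fix t :: real assume "t \<in> {0..}"
      then have "norm (f t) \<le> C * exp (- c * t)" using b by simp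
      then show "norm (f t) \<le> norm (C * exp (- c * t))"
        unfolding real_norm_def by (rule order_trans[OF _ abs_ge_self])
    qed
  qed
  have eq: "indicator {0..} t *\<^sub>R f t = (if t < 0 then 0 else f t)" for t
    by (auto simp: indicator_def)
  have "(\<lambda>t. if t < 0 then 0 else f t) \<in> borel_measurable lborel"
    using f by measurable
  then show "integrable lborel (\<lambda>t. if t < 0 then 0 else f t)"
    using s by (simp add: set_integrable_def eq integrable_completion)
qed

lemma exp_decay_imp_L2_Rplus:
  fixes f :: "real \<Rightarrow> complex^'p"
  assumes "c > 0" and f: "f \<in> borel_measurable borel"
    and b: "\<And>t. 0 \<le> t \<Longrightarrow> norm (f t) \<le> C * exp (- c * t)"
  shows "f \<in> L2_Rplus"
proof -
  have C: "0 \<le> C" using order_trans[OF norm_ge_zero b[of 0]] by simp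
  have "set_integrable lebesgue {0..} (\<lambda>t. (norm (f t))\<^sup>2)"
  proof (rule exp_decay_imp_set_integrable(1)[OF assms(1)])
    show "(\<lambda>t. (norm (f t))\<^sup>2) \<in> borel_measurable borel" using f by measurable
    fix t :: real assume t: "0 \<le> t"
    have "C * exp (- c * t) \<le> C" using C t assms(1) by (simp add: mult_left_le)
    then have "norm (f t) \<le> C" using b[OF t] by simp
    then have "norm (f t) * norm (f t) \<le> C * (C * exp (- c * t))"
      by (intro mult_mono b t) (auto simp: C)
    then show "norm ((norm (f t))\<^sup>2) \<le> (C * C) * exp (- c * t)"
      by (simp add: power2_eq_square mult_ac)
  qed
  moreover have "set_borel_measurable lebesgue {0..} f"
    using exp_decay_imp_set_integrable(1)[OF assms]
    by (auto simp: set_integrable_def set_borel_measurable_def)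
  ultimately show ?thesis by (simp add: L2_Rplus_def)
qed

lemma stabilizable_imp_decay:
  assumes "stabilizable A B"
  obtains F E c D where "matrix_flow (A + B ** F) E" "c > 0" "\<And>t. 0 \<le> t \<Longrightarrow> norm (E t) \<le> D * exp (- c * t)"
proof -
  obtain F where F: "\<forall>z\<in>spectrum (A + B ** F). Re z < 0"
    using assms by (auto simp: stabilizable_def)
  \<comment> \<open>The extra -1 makes the set nonempty, so its maximum is defined without
    exhibiting an eigenvalue.\<close>
  define S where "S = insert (-1) (Re ` spectrum (A + B ** F))"
  have S: "finite S" "S \<noteq> {}" by (auto simp: S_def finite_spectrum)
  have neg: "Max S < 0" using S F by (subst Max_less_iff) (auto simp: S_def)
  \<comment> \<open>Half of the gap, because \<open>matrix_exponential\<close> needs all real parts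
    strictly below -c.\<close>
  define c where "c = - Max S / 2"
  have "Re z < - c" if "z \<in> spectrum (A + B ** F)" for z
  proof -
    have "Re z \<le> Max S" using that S by (intro Max_ge) (auto simp: S_def)
    then show ?thesis using neg by (simp add: c_def)
  qed
  then obtain E D where "matrix_flow (A + B ** F) E" "\<And>t. 0 \<le> t \<Longrightarrow> norm (E t) \<le> D * exp (- c * t)"
    using matrix_exponential[of "A + B ** F"] unfolding matrix_flow_def by metis
  moreover have "c > 0" using neg by (simp add: c_def)
  ultimately show thesis using that by blast
qed

locale stabilized_system =
  fixes A :: "complex^'n^'n" and B :: "complex^'m^'n" and F :: "complex^'n^'m"
    and E :: "real \<Rightarrow> complex^'n^'n" and c D :: real and M :: "complex^('n + 'm)^('n + 'm)"
  assumes flow: "matrix_flow (A + B ** F) E" and c_pos: "c > 0"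
    and E_bound: "\<And>t. 0 \<le> t \<Longrightarrow> norm (E t) \<le> D * exp (- c * t)"
begin

sublocale closed_loop: matrix_flow "A + B ** F" E by (rule flow)

lemma D_nonneg: "0 \<le> D"
  using order_trans[OF norm_ge_zero E_bound[of 0]] by simp

text \<open>One constant serves state and feedback input. The bound is linear in |\<xi>|, so the
  cost of the continuation becomes a multiple of |x(T)|^2.\<close>

lemma feedback_bound:
  obtains K where "K > 0" "\<And>t \<xi>. 0 \<le> t \<Longrightarrow> norm (E t *v \<xi>) \<le> K * norm \<xi> * exp (- c * t)"
    "\<And>t \<xi>. 0 \<le> t \<Longrightarrow> norm (F *v (E t *v \<xi>)) \<le> K * norm \<xi> * exp (- c * t)"
proof -
  obtain K1 where K1: "K1 > 0" "\<And>X (x :: complex^'n). norm ((X :: complex^'n^'n) *v x) \<le> norm X * norm x * K1"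
    using bounded_bilinear.pos_bounded[OF bounded_bilinear_matrix_vector] by blast
  obtain K2 where K2: "K2 > 0" "\<And>x. norm (F *v x) \<le> norm x * K2"
    using bounded_linear.pos_bounded[OF bounded_linear_matrix_vector] by blast
  have 1: "norm (E t *v \<xi>) \<le> (D * K1) * norm \<xi> * exp (- c * t)" if "0 \<le> t" for t \<xi>
  proof -
    have "norm (E t *v \<xi>) \<le> norm (E t) * norm \<xi> * K1" by (rule K1)
    also have "\<dots> \<le> (D * exp (- c * t)) * norm \<xi> * K1"
      using K1(1) E_bound[OF that] by (intro mult_right_mono) auto
    finally show ?thesis by (simp add: mult_ac)
  qed
  have 2: "norm (F *v (E t *v \<xi>)) \<le> (D * K1 * K2) * norm \<xi> * exp (- c * t)" if "0 \<le> t" for t \<xi>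
  proof -
    have "norm (F *v (E t *v \<xi>)) \<le> norm (E t *v \<xi>) * K2" by (rule K2)
    also have "\<dots> \<le> (D * K1) * norm \<xi> * exp (- c * t) * K2"
      using K2(1) 1[OF that] by (intro mult_right_mono) auto
    finally show ?thesis by (simp add: mult_ac)
  qed
  define K where "K = D * K1 + D * K1 * K2 + 1"
  have "D * K1 \<le> K" "D * K1 * K2 \<le> K" "K > 0"
    using D_nonneg K1(1) K2(1) by (auto simp: K_def add_nonneg_pos)
  then show thesis
    by (intro that[of K] order_trans[OF 1] order_trans[OF 2] mult_right_mono) auto
qed

text \<open>The closed loop is started at time T in x(T). Since \<open>E 0 = mat 1\<close> the state
  remains continuous, while the input may jump; the strict inequality makes the given part live on
  the half-open interval below T.\<close>

definition ext_x :: "real \<Rightarrow> (real \<Rightarrow> complex^'n) \<Rightarrow> real \<Rightarrow> complex^'n" where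
  "ext_x T x t = (if t < T then x t else E (t - T) *v x T)"

definition ext_u :: "real \<Rightarrow> (real \<Rightarrow> complex^'n) \<Rightarrow> (real \<Rightarrow> complex^'m) \<Rightarrow> real \<Rightarrow> complex^'m" where
  "ext_u T x u t = (if t < T then u t else F *v (E (t - T) *v x T))"

definition ext :: "real \<Rightarrow> (real \<Rightarrow> complex^'n) \<Rightarrow> (real \<Rightarrow> complex^'m) \<Rightarrow> real \<Rightarrow> complex^('n + 'm)" where
  "ext T x u t = vstack (ext_x T x t) (ext_u T x u t)"

context
  fixes T :: real and x :: "real \<Rightarrow> complex^'n" and u :: "real \<Rightarrow> complex^'m"
  assumes T: "0 < T" and xc: "continuous_on UNIV x" and uc: "continuous_on UNIV u"
begin

lemma xu_borel: "x \<in> borel_measurable borel" "u \<in> borel_measurable borel"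
  using xc uc by (auto intro: borel_measurable_continuous_onI)

lemma feedback_continuous: "continuous_on S (\<lambda>t. E (t - T) *v x T)" "continuous_on S (\<lambda>t. F *v (E (t - T) *v x T))"
  by (intro continuous_intros)+

lemma ext_x_continuous: "continuous_on UNIV (ext_x T x)"
proof -
  have "continuous_on UNIV (\<lambda>t. if t \<le> T then x t else E (t - T) *v x T)"
    by (rule continuous_on_cases_le)
       (auto intro!: feedback_continuous continuous_on_subset[OF xc] simp: closed_loop.E_0)
  moreover have "(\<lambda>t. if t \<le> T then x t else E (t - T) *v x T) = ext_x T x"
    by (auto simp: ext_x_def fun_eq_iff closed_loop.E_0)
  ultimately show ?thesis by (simp only:)
qed

lemma ext_x_borel: "ext_x T x \<in> borel_measurable borel"
  using ext_x_continuous by (rule borel_measurable_continuous_onI)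

lemma ext_u_borel: "ext_u T x u \<in> borel_measurable borel"
proof -
  have "(\<lambda>t. F *v (E (t - T) *v x T)) \<in> borel_measurable borel"
    using feedback_continuous(2) by (rule borel_measurable_continuous_onI)
  then show ?thesis
    unfolding ext_u_def[abs_def] using xu_borel by measurable
qed

lemma ext_borel: "ext T x u \<in> borel_measurable borel"
proof -
  have "(\<lambda>p. vstack (fst p) (snd p)) \<in> borel_measurable (borel :: ((complex^'n) \<times> (complex^'m)) measure)"
    by (intro borel_measurable_continuous_onI continuous_intros)
  from measurable_compose[OF borel_measurable_Pair[OF ext_x_borel ext_u_borel] this]
  show ?thesis by (simp add: ext_def[abs_def])
qed

lemma ext_bound:
  obtains C where "\<And>t. 0 \<le> t \<Longrightarrow> norm (ext T x u t) \<le> C * exp (- c * t)"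
proof -
  obtain K where K: "K > 0" "\<And>t \<xi>. 0 \<le> t \<Longrightarrow> norm (E t *v \<xi>) \<le> K * norm \<xi> * exp (- c * t)"
    "\<And>t \<xi>. 0 \<le> t \<Longrightarrow> norm (F *v (E t *v \<xi>)) \<le> K * norm \<xi> * exp (- c * t)"
    by (rule feedback_bound) (rule that)
  have "compact ((\<lambda>t. vstack (x t) (u t)) ` {0..T})"
    by (intro compact_continuous_image continuous_intros continuous_on_subset[OF xc] continuous_on_subset[OF uc]) auto
  then have "bounded ((\<lambda>t. vstack (x t) (u t)) ` {0..T})" by (rule compact_imp_bounded)
  then obtain L where L: "L > 0" "\<And>t. t \<in> {0..T} \<Longrightarrow> norm (vstack (x t) (u t)) \<le> L"
    unfolding bounded_pos by auto
  \<comment> \<open>\<open>L\<close> covers the compact interval and 2 K |x(T)| the tail, twice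
    because state and input both contribute. The factor exp (c T) shifts the start of the decay from
    T back to 0.\<close>
  define C where "C = (L + 2 * K * norm (x T)) * exp (c * T)"
  have "norm (ext T x u t) \<le> C * exp (- c * t)" if t: "0 \<le> t" for t
  proof (cases "t < T")
    case True
    have "norm (ext T x u t) \<le> L * 1"
      using True t L(2)[of t] by (simp add: ext_def ext_x_def ext_u_def)
    also have "\<dots> \<le> L * exp (c * T - c * t)"
      using L(1) True c_pos by (intro mult_left_mono) auto
    also have "\<dots> \<le> C * exp (- c * t)"
      using K(1) by (simp add: C_def exp_diff exp_minus field_simps)
    finally show ?thesis .
  next
    case False
    have "norm (ext T x u t) \<le> norm (ext_x T x t) + norm (ext_u T x u t)"
      unfolding ext_def by (rule norm_vstack_le)
    also have "\<dots> \<le> K * norm (x T) * exp (- c * (t - T)) + K * norm (x T) * exp (- c * (t - T))"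
      using False K(2)[of "t - T" "x T"] K(3)[of "t - T" "x T"] by (intro add_mono) (simp_all add: ext_x_def ext_u_def)
    also have "\<dots> = 2 * K * norm (x T) * exp (c * T) * exp (- c * t)"
      by (simp add: exp_add[symmetric] algebra_simps)
    also have "\<dots> \<le> C * exp (- c * t)"
      using L(1) by (simp add: C_def algebra_simps)
    finally show ?thesis .
  qed
  then show thesis by (rule that)
qed

lemma ext_x_decay: "\<exists>C. \<forall>t\<ge>0. norm (ext_x T x t) \<le> C * exp (- c * t)"
  and ext_u_decay: "\<exists>C. \<forall>t\<ge>0. norm (ext_u T x u t) \<le> C * exp (- c * t)"
proof -
  obtain C where C: "\<And>t. 0 \<le> t \<Longrightarrow> norm (ext T x u t) \<le> C * exp (- c * t)"
    by (rule ext_bound) (rule that)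
  have "norm (ext_x T x t) \<le> norm (ext T x u t)" "norm (ext_u T x u t) \<le> norm (ext T x u t)" for t
    by (rule power2_le_imp_le; simp add: ext_def norm_vstack)+
  then show "\<exists>C. \<forall>t\<ge>0. norm (ext_x T x t) \<le> C * exp (- c * t)" "\<exists>C. \<forall>t\<ge>0. norm (ext_u T x u t) \<le> C * exp (- c * t)"
    using C order_trans by meson+
qed

lemma ext_L2: "ext_x T x \<in> L2_Rplus" "ext_u T x u \<in> L2_Rplus"
  using ext_x_decay ext_u_decay exp_decay_imp_L2_Rplus[OF c_pos ext_x_borel] exp_decay_imp_L2_Rplus[OF c_pos ext_u_borel]
  by blast+

lemma cquad_ext_integrable:
  "set_integrable lebesgue {0..} (\<lambda>t. cquad M (ext T x u t))"
proof -
  obtain C where C: "\<And>t. 0 \<le> t \<Longrightarrow> norm (ext T x u t) \<le> C * exp (- c * t)"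
    by (rule ext_bound) (rule that)
  obtain K where K: "K > 0" "\<And>v. norm (cquad M v) \<le> K * (norm v)\<^sup>2"
    by (rule cquad_bound) (rule that)
  show ?thesis
  proof (rule exp_decay_imp_set_integrable(1)[of "2 * c"])
    show "0 < 2 * c" using c_pos by simp
    have "cquad M \<in> borel_measurable borel"
      by (intro borel_measurable_continuous_onI continuous_intros)
    from measurable_compose[OF ext_borel this] show "(\<lambda>t. cquad M (ext T x u t)) \<in> borel_measurable borel" .
    fix t :: real assume t: "0 \<le> t"
    have "norm (cquad M (ext T x u t)) \<le> K * (C * exp (- c * t))\<^sup>2"
      using K C[OF t] by (intro order_trans[OF K(2)] mult_left_mono power_mono) auto
    also have "\<dots> = (K * C\<^sup>2) * exp (- (2 * c) * t)"
      by (simp add: power_mult_distrib exp_double[symmetric] mult_ac)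
    finally show "norm (cquad M (ext T x u t)) \<le> (K * C\<^sup>2) * exp (- (2 * c) * t)" .
  qed
qed

lemma ext_deriv:
  assumes d: "\<And>t. 0 < t \<Longrightarrow> t < T \<Longrightarrow> (x has_vector_derivative (A *v x t + B *v u t)) (at t)"
    and t: "0 < t" "t \<noteq> T"
  shows "(ext_x T x has_vector_derivative (A *v ext_x T x t + B *v ext_u T x u t)) (at t)"
proof (cases "t < T")
  case True
  have "(ext_x T x has_vector_derivative (A *v x t + B *v u t)) (at t)"
    by (rule has_vector_derivative_transform_within_open[OF d[OF t(1) True], of "{..<T}"])
       (use True in \<open>auto simp: ext_x_def\<close>)
  then show ?thesis using True by (simp add: ext_x_def ext_u_def)
next
  case False
  then have "T < t" using t by simp
  have "(((\<lambda>s. E s *v x T) \<circ> (\<lambda>t. t - T)) has_vector_derivative (1 *\<^sub>R ((A + B ** F) *v (E (t - T) *v x T)))) (at t)"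
    by (intro vector_diff_chain_within closed_loop.E_vector_deriv) (auto intro!: derivative_eq_intros)
  then have "((\<lambda>t. E (t - T) *v x T) has_vector_derivative ((A + B ** F) *v (E (t - T) *v x T))) (at t)"
    by (simp add: o_def)
  then have "(ext_x T x has_vector_derivative ((A + B ** F) *v (E (t - T) *v x T))) (at t)"
    by (rule has_vector_derivative_transform_within_open[of _ _ _ "{T<..}"])
       (use \<open>T < t\<close> in \<open>auto simp: ext_x_def\<close>)
  then show ?thesis using False
    by (simp add: ext_x_def ext_u_def matrix_vector_mult_add_rdistrib matrix_vector_mul_assoc matrix_mul_assoc
        matrix_add_rdistrib)
qed

lemma ext_is_solution:
  assumes "\<And>t. 0 < t \<Longrightarrow> t < T \<Longrightarrow> (x has_vector_derivative (A *v x t + B *v u t)) (at t)"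
  shows "is_solution A B (x 0) (ext_u T x u) (ext_x T x)"
proof -
  have "is_solution A B (ext_x T x 0) (ext_u T x u) (ext_x T x)"
    by (rule is_solution_piecewise[of _ "{T}"])
       (auto intro: continuous_on_subset[OF ext_x_continuous] ext_deriv assms L2_Rplus_imp_locally_integrable ext_L2)
  then show ?thesis using T by (simp add: ext_x_def)
qed

text \<open>The excluded points are the only possible jumps: at 0 the input leaves the value zero
  prescribed at negative times, at T it switches to feedback.\<close>

lemma ext_isCont:
  assumes "t \<noteq> 0" "t \<noteq> T"
  shows "isCont (\<lambda>t. if t < 0 then 0 else ext T x u t) t"
proof -
  have *: "isCont (\<lambda>t. if t < 0 then 0 else ext T x u t) t"
    if "open S" "t \<in> S" "\<And>s. s \<in> S \<Longrightarrow> (if s < 0 then 0 else ext T x u s) = g s" "continuous_on S g" for S g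
  proof -
    have "continuous_on S (\<lambda>t. if t < 0 then 0 else ext T x u t)"
      by (rule continuous_on_eq[OF that(4)]) (rule that(3)[symmetric])
    then show ?thesis using that(1,2) continuous_on_eq_continuous_at by blast
  qed
  consider "t < 0" | "0 < t" "t < T" | "T < t" using assms by linarith
  then show ?thesis
  proof cases
    case 1
    show ?thesis by (rule *[of "{..<0}" "\<lambda>t. 0"]) (use 1 in auto)
  next
    case 2
    show ?thesis
      by (rule *[of "{0<..<T}" "\<lambda>t. vstack (x t) (u t)"])
         (use 2 in \<open>auto simp: ext_def ext_x_def ext_u_def intro!: continuous_intros continuous_on_subset[OF xc] continuous_on_subset[OF uc]\<close>)
  next
    case 3
    show ?thesis
      by (rule *[of "{T<..}" "\<lambda>t. vstack (E (t - T) *v x T) (F *v (E (t - T) *v x T))"])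
         (use 3 T in \<open>auto simp: ext_def ext_x_def ext_u_def intro!: continuous_intros\<close>)
  qed
qed

text \<open>The initial value \<open>x 0 = 0\<close> removes the boundary term from the transformed
  differential equation, so that the transforms satisfy exactly the resolvent relation required by
  \<open>cquad_popov\<close>.\<close>

lemma cost_ext_nonneg:
  assumes d: "\<And>t. 0 < t \<Longrightarrow> t < T \<Longrightarrow> (x has_vector_derivative (A *v x t + B *v u t)) (at t)"
    and x0: "x 0 = 0"
    and popov: "\<And>\<omega>. \<i> * of_real \<omega> \<notin> spectrum A \<Longrightarrow> pos_semidef (popov A B M \<omega>)"
  shows "0 \<le> Re (LINT t:{0..}|lebesgue. cquad M (ext T x u t))"
proof -
  define z where "z t = (if t < 0 then 0 else ext T x u t)" for t
  obtain C where C: "\<And>t. 0 \<le> t \<Longrightarrow> norm (ext T x u t) \<le> C * exp (- c * t)"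
    by (rule ext_bound) (rule that)
  have C0: "0 \<le> C" using order_trans[OF norm_ge_zero C[of 0]] by simp
  \<comment> \<open>Frequencies without a resolvent. They embed injectively into the spectrum, hence
    are finitely many.\<close>
  define S where "S = {\<omega>. \<i> * complex_of_real \<omega> \<in> spectrum A}"
  have S: "finite S"
    unfolding S_def using finite_spectrum
    by (intro finite_vimageI[of "spectrum A" "\<lambda>\<omega>. \<i> * complex_of_real \<omega>", unfolded vimage_def]) (auto intro: injI)
  have zi: "integrable lborel (\<lambda>t. z t $ i)" for i
  proof -
    have "(\<lambda>t. ext T x u t $ i) \<in> borel_measurable borel"
      using measurable_compose[OF ext_borel borel_measurable_continuous_onI[of "\<lambda>v. v $ i"]]
      by (simp add: continuous_on_component)
    then have "integrable lborel (\<lambda>t. if t < 0 then 0 else ext T x u t $ i)"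
      by (rule exp_decay_imp_set_integrable(2)[OF c_pos]) (rule order_trans[OF Finite_Cartesian_Product.norm_nth_le C])
    moreover have "(\<lambda>t. z t $ i) = (\<lambda>t. if t < 0 then 0 else ext T x u t $ i)"
      by (auto simp: z_def)
    ultimately show ?thesis by simp
  qed
  define xh where "xh i = (\<lambda>t. z t $ Inl i)" for i
  define uh where "uh j = (\<lambda>t. z t $ Inr j)" for j
  have xhi: "integrable lborel (xh i)" and uhi: "integrable lborel (uh j)" for i j
    by (simp_all add: xh_def uh_def zi)
  have rel: "\<i> * complex_of_real \<omega> * fourier (xh i) \<omega> = (\<Sum>j\<in>UNIV. A $ i $ j * fourier (xh j) \<omega>) + (\<Sum>j\<in>UNIV. B $ i $ j * fourier (uh j) \<omega>)" for \<omega> i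
  proof -
    \<comment> \<open>The derivative of the i-th state component, written as a combination of
      integrable scalar functions. Its transform is computed twice, by \<open>fourier_deriv\<close>
      and by linearity.\<close>
    define y where "y t = (\<Sum>j\<in>UNIV. A $ i $ j * xh j t) + (\<Sum>j\<in>UNIV. B $ i $ j * uh j t)" for t
    have yi: "integrable lborel y"
      unfolding y_def by (intro Bochner_Integration.integrable_add Bochner_Integration.integrable_sum integrable_mult_right xhi uhi)
    have xe: "xh i t = ext_x T x t $ i" if "0 \<le> t" for t i
      using that by (simp add: xh_def z_def ext_def)
    have ue: "uh i t = ext_u T x u t $ i" if "0 \<le> t" for t i
      using that by (simp add: uh_def z_def ext_def)
    have "fourier y \<omega> = \<i> * complex_of_real \<omega> * fourier (xh i) \<omega>"
    proof (rule fourier_deriv[OF xhi yi])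
      show "xh i t = 0" if "t < 0" for t using that by (simp add: xh_def z_def)
      show "y t = 0" if "t < 0" for t using that by (simp add: y_def xh_def uh_def z_def)
      have "continuous_on {0..} (\<lambda>t. ext_x T x t $ i)"
        by (intro continuous_on_component continuous_on_subset[OF ext_x_continuous]) auto
      then show "continuous_on {0..} (xh i)"
        by (rule continuous_on_eq) (simp add: xe)
      show "xh i 0 = 0" using T x0 by (simp add: xe ext_x_def)
      show "(xh i \<longlongrightarrow> 0) at_top"
      proof (rule Lim_null_comparison)
        show "\<forall>\<^sub>F t in at_top. norm (xh i t) \<le> C * exp (- c * t)"
          using eventually_ge_at_top[of 0]
        proof eventually_elim
          case (elim t)
          have "norm (xh i t) \<le> norm (ext T x u t)"
            using elim unfolding xh_def z_def by (simp add: Finite_Cartesian_Product.norm_nth_le)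
          then show ?case using C[OF elim] by simp
        qed
        have "LIM t at_top. - c * t :> at_bot"
          using c_pos by (intro filterlim_tendsto_neg_mult_at_bot[of _ "- c"] tendsto_const filterlim_ident) auto
        then have "((\<lambda>t. exp (- c * t)) \<longlongrightarrow> 0) at_top"
          by (rule filterlim_compose[OF exp_at_bot])
        then show "((\<lambda>t. C * exp (- c * t)) \<longlongrightarrow> 0) at_top"
          by (rule tendsto_mult_right_zero)
      qed
      show "finite {T}" by simp
      fix t assume t: "0 < t" "t \<notin> {T}"
      have "((\<lambda>t. ext_x T x t $ i) has_vector_derivative ((A *v ext_x T x t + B *v ext_u T x u t) $ i)) (at t)"
        using t by (intro bounded_linear.has_vector_derivative[OF bounded_linear_vec_nth] ext_deriv d) auto
      moreover have "(A *v ext_x T x t + B *v ext_u T x u t) $ i = y t"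
        using t by (simp add: y_def matrix_vector_mult_def xe ue)
      ultimately have "((\<lambda>t. ext_x T x t $ i) has_vector_derivative y t) (at t)" by simp
      then show "(xh i has_vector_derivative y t) (at t)"
        by (rule has_vector_derivative_transform_within_open[of _ _ _ "{0<..}"]) (use t xe in auto)
    qed
    moreover have "fourier y \<omega> = (\<Sum>j\<in>UNIV. A $ i $ j * fourier (xh j) \<omega>) + (\<Sum>j\<in>UNIV. B $ i $ j * fourier (uh j) \<omega>)"
    proof -
      have ii: "integrable lborel (\<lambda>t. a * (iexp (- (\<omega> * t)) * f t))" if "integrable lborel f" for f a
        using integrable_iexp_mult[OF that] by simp
      have "iexp (- (\<omega> * t)) * y t = (\<Sum>j\<in>UNIV. A $ i $ j * (iexp (- (\<omega> * t)) * xh j t)) + (\<Sum>j\<in>UNIV. B $ i $ j * (iexp (- (\<omega> * t)) * uh j t))" for t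
        by (simp only: y_def distrib_left sum_distrib_left mult.left_commute)
      then have "fourier y \<omega> = (LINT t|lborel. (\<Sum>j\<in>UNIV. A $ i $ j * (iexp (- (\<omega> * t)) * xh j t)) + (\<Sum>j\<in>UNIV. B $ i $ j * (iexp (- (\<omega> * t)) * uh j t)))"
        by (simp only: fourier_def)
      also have "\<dots> = (\<Sum>j\<in>UNIV. A $ i $ j * fourier (xh j) \<omega>) + (\<Sum>j\<in>UNIV. B $ i $ j * fourier (uh j) \<omega>)"
        unfolding fourier_def
        by (simp only: Bochner_Integration.integral_add Bochner_Integration.integrable_sum Bochner_Integration.integral_sum ii xhi uhi integral_mult_right_zero)
      finally show ?thesis .
    qed
    ultimately show ?thesis by simp
  qed
  have "0 \<le> Re (LINT t|lborel. cquad M (z t))"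
  proof (rule fourier_nonneg_imp_nonneg[OF zi _ _ S])
    show "norm (z t) \<le> C" for t
    proof (cases "t < 0")
      case False
      then have "C * exp (- c * t) \<le> C" using C0 c_pos by (simp add: mult_left_le)
      then show ?thesis using C[of t] False by (simp add: z_def)
    qed (simp add: z_def C0)
    have "AE t in lborel. t \<notin> {0, T}"
      by (intro AE_not_in finite_imp_null_set_lborel) auto
    then show "AE t in lborel. isCont z t"
      unfolding z_def by eventually_elim (auto intro: ext_isCont)
    fix \<omega> assume "\<omega> \<notin> S"
    then have ns: "\<i> * complex_of_real \<omega> \<notin> spectrum A" by (simp add: S_def)
    define X where "X = (\<chi> i. fourier (xh i) \<omega>)"
    define U where "U = (\<chi> j. fourier (uh j) \<omega>)"
    have "(\<chi> i. fourier (\<lambda>t. z t $ i) \<omega>) = vstack X U"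
      by (simp add: vec_eq_iff all_Plus X_def U_def xh_def uh_def)
    \<comment> \<open>By \<open>rel\<close>, X is the resolvent applied to B U, so the form at (X,
      U) is the value of the Popov matrix at U.\<close>
    moreover have "cquad (popov A B M \<omega>) U = cquad M (vstack X U)"
      by (rule cquad_popov[OF ns]) (simp add: vec_eq_iff X_def U_def matrix_vector_mult_def rel)
    moreover have "0 \<le> cquad (popov A B M \<omega>) U"
      using popov[OF ns] by (simp add: pos_semidef_def)
    ultimately show "0 \<le> Re (cquad M (\<chi> i. fourier (\<lambda>t. z t $ i) \<omega>))"
      by (simp add: less_eq_complex_def)
  qed
  moreover have "(LINT t|lborel. cquad M (z t)) = (LINT t:{0..}|lebesgue. cquad M (ext T x u t))"
  proof -
    have "cquad M 0 = 0" by (simp add: cquad_def)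
    then have eq: "indicator {0..} t *\<^sub>R cquad M (ext T x u t) = cquad M (z t)" for t
      by (auto simp: z_def indicator_def)
    have "cquad M \<in> borel_measurable borel"
      by (intro borel_measurable_continuous_onI continuous_intros)
    moreover have "z \<in> borel_measurable borel"
      unfolding z_def[abs_def] using ext_borel by measurable
    ultimately have "(\<lambda>t. cquad M (z t)) \<in> borel_measurable lborel"
      using measurable_compose by auto
    then show ?thesis
      by (simp add: set_lebesgue_integral_def eq integral_completion)
  qed
  ultimately show ?thesis by simp
qed

end

lemma ext_cost_tail:
  obtains K where "K > 0" "\<And>T x u. 0 < T \<Longrightarrow> continuous_on UNIV x \<Longrightarrow> continuous_on UNIV u \<Longrightarrow>
     norm ((LINT t:{0..}|lebesgue. cquad M (ext T x u t)) - (LINT t:{0..<T}|lebesgue. cquad M (vstack (x t) (u t))))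
       \<le> K * (norm (x T))\<^sup>2"
proof -
  obtain K where K: "K > 0" "\<And>t \<xi>. 0 \<le> t \<Longrightarrow> norm (E t *v \<xi>) \<le> K * norm \<xi> * exp (- c * t)"
    "\<And>t \<xi>. 0 \<le> t \<Longrightarrow> norm (F *v (E t *v \<xi>)) \<le> K * norm \<xi> * exp (- c * t)"
    by (rule feedback_bound) (rule that)
  obtain L where L: "L > 0" "\<And>v. norm (cquad M v) \<le> L * (norm v)\<^sup>2"
    by (rule cquad_bound) (rule that)
  \<comment> \<open>The integral over t \<ge> T of L (2 K |x(T)| exp (-c (t - T)))^2, divided by
    |x(T)|^2.\<close>
  define K' where "K' = L * (2 * K)\<^sup>2 / (2 * c)"
  show thesis
  proof (rule that[of K'])
    show "K' > 0" using K(1) L(1) c_pos by (simp add: K'_def)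
    fix T :: real and x :: "real \<Rightarrow> complex^'n" and u :: "real \<Rightarrow> complex^'m"
    assume T: "0 < T" and xc: "continuous_on UNIV x" and uc: "continuous_on UNIV u"
    define f where "f t = cquad M (ext T x u t)" for t
    have fi: "set_integrable lebesgue {0..} f"
      unfolding f_def by (rule cquad_ext_integrable[OF T xc uc])
    have fT: "set_integrable lebesgue {T..} f"
      by (rule set_integrable_subset[OF fi]) (use T in auto)
    have "(LINT t:{0..}|lebesgue. f t) = (LINT t:{0..<T} \<union> {T..}|lebesgue. f t)"
      using T by (intro arg_cong[of _ _ "\<lambda>S. set_lebesgue_integral lebesgue S f"]) auto
    also have "\<dots> = (LINT t:{0..<T}|lebesgue. f t) + (LINT t:{T..}|lebesgue. f t)"
      by (rule set_integral_Un) (use T in \<open>auto intro: set_integrable_subset[OF fi]\<close>)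
    also have "(LINT t:{0..<T}|lebesgue. f t) = (LINT t:{0..<T}|lebesgue. cquad M (vstack (x t) (u t)))"
      unfolding set_lebesgue_integral_def
      by (intro Bochner_Integration.integral_cong) (auto simp: f_def ext_def ext_x_def ext_u_def indicator_def)
    finally have "(LINT t:{0..}|lebesgue. f t) - (LINT t:{0..<T}|lebesgue. cquad M (vstack (x t) (u t))) = (LINT t:{T..}|lebesgue. f t)"
      by simp
    moreover have "norm (LINT t:{T..}|lebesgue. f t) \<le> K' * (norm (x T))\<^sup>2"
    proof -
      \<comment> \<open>The factor exp (2 c T) is moved into the constant so that the bound is a
        plain exponential in t; it cancels after integration from T.\<close>
      define R where "R = L * (2 * K)\<^sup>2 * (norm (x T))\<^sup>2 * exp (2 * c * T)"
      have gi: "set_integrable lebesgue {T..} (\<lambda>t. R * exp (- (2 * c) * t))"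
        using exp_decay_set_integrable[of "2 * c" T] c_pos by simp
      have "norm (LINT t:{T..}|lebesgue. f t) \<le> (LINT t:{T..}|lebesgue. norm (f t))"
        by (rule set_integral_norm_bound[OF fT])
      also have "\<dots> \<le> (LINT t:{T..}|lebesgue. R * exp (- (2 * c) * t))"
      proof (rule set_integral_mono[OF set_integrable_norm[OF fT] gi])
        fix t assume t: "t \<in> {T..}"
        have "norm (ext T x u t) \<le> norm (ext_x T x t) + norm (ext_u T x u t)"
          unfolding ext_def by (rule norm_vstack_le)
        also have "\<dots> \<le> K * norm (x T) * exp (- c * (t - T)) + K * norm (x T) * exp (- c * (t - T))"
          using t K(2)[of "t - T" "x T"] K(3)[of "t - T" "x T"] by (intro add_mono) (simp_all add: ext_x_def ext_u_def)
        finally have n: "norm (ext T x u t) \<le> 2 * K * norm (x T) * exp (- c * (t - T))" by simp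
        have "norm (f t) \<le> L * (2 * K * norm (x T) * exp (- c * (t - T)))\<^sup>2"
          unfolding f_def using L(1) n by (intro order_trans[OF L(2)] mult_left_mono power_mono) auto
        also have "\<dots> = L * (2 * K)\<^sup>2 * (norm (x T))\<^sup>2 * (exp (- c * (t - T)))\<^sup>2"
          by (simp add: power_mult_distrib)
        also have "(exp (- c * (t - T)))\<^sup>2 = exp (2 * c * T) * exp (- (2 * c) * t)"
          by (simp add: exp_double[symmetric] exp_add[symmetric] algebra_simps)
        finally show "norm (f t) \<le> R * exp (- (2 * c) * t)"
          by (simp add: R_def mult_ac)
      qed
      also have "\<dots> = integral {T..} (\<lambda>t. R * exp (- (2 * c) * t))"
        by (rule set_lebesgue_integral_eq_integral(2)[OF gi])
      also have "\<dots> = R * (exp (- (2 * c) * T) / (2 * c))"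
        by (intro integral_unique has_integral_mult_right has_integral_exp_minus_to_infinity) (use c_pos in simp)
      also have "\<dots> = K' * (norm (x T))\<^sup>2 * (exp (2 * c * T) * exp (- (2 * c) * T))"
        by (simp add: R_def K'_def)
      also have "exp (2 * c * T) * exp (- (2 * c) * T) = 1"
        by (simp add: exp_add[symmetric])
      finally show ?thesis by simp
    qed
    ultimately show "norm ((LINT t:{0..}|lebesgue. cquad M (ext T x u t)) - (LINT t:{0..<T}|lebesgue. cquad M (vstack (x t) (u t))))
       \<le> K' * (norm (x T))\<^sup>2"
      by (simp add: f_def)
  qed
qed

end

subsection \<open>Inputs that are only square-integrable\<close>

lemma continuous_on_atLeast:
  fixes f :: "real \<Rightarrow> 'b::topological_space"
  assumes "\<And>t. a \<le> t \<Longrightarrow> continuous_on {a..t} f"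
  shows "continuous_on {a..} f"
  unfolding continuous_on_eq_continuous_within
proof
  fix s assume s: "s \<in> {a..}"
  have "continuous (at s within {a..s + 1}) f"
    using assms[of "s + 1"] s by (auto simp: continuous_on_eq_continuous_within)
  moreover have "at s within {a..} = at s within {a..s + 1}"
    by (rule at_within_nhd[of _ "{..<s + 1}"]) auto
  ultimately show "continuous (at s within {a..}) f" by simp
qed

lemma borel_measurable_cquad_vstack:
  fixes x :: "'z \<Rightarrow> complex^'n" and u :: "'z \<Rightarrow> complex^'m"
  assumes "x \<in> borel_measurable N" "u \<in> borel_measurable N"
  shows "(\<lambda>t. cquad M (vstack (x t) (u t))) \<in> borel_measurable N"
proof -
  have "(\<lambda>p. cquad M (vstack (fst p) (snd p))) \<in> borel_measurable (borel :: ((complex^'n) \<times> (complex^'m)) measure)"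
    by (intro borel_measurable_continuous_onI continuous_intros)
  from measurable_compose[OF borel_measurable_Pair[OF assms] this] show ?thesis by simp
qed

lemma continuous_imp_lebesgue_measurable:
  fixes f :: "real \<Rightarrow> 'b::{banach, second_countable_topology}"
  assumes "continuous_on UNIV f"
  shows "f \<in> borel_measurable lebesgue"
  by (intro measurable_completion) (simp add: borel_measurable_continuous_onI[OF assms])

lemma bounded_imp_set_integrable:
  fixes f :: "real \<Rightarrow> 'b::{banach, second_countable_topology}"
  assumes "f \<in> borel_measurable lebesgue" "\<And>t. norm (f t) \<le> w t" "set_integrable lebesgue {a..b} w"
  shows "set_integrable lebesgue {a..b} f"
proof (rule set_integrable_bound[OF assms(3)])
  show "set_borel_measurable lebesgue {a..b} f"
    unfolding set_borel_measurable_def using assms(1) by (intro borel_measurable_scaleR borel_measurable_indicator) auto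
  show "AE t in lebesgue. t \<in> {a..b} \<longrightarrow> norm (f t) \<le> norm (w t)"
    unfolding real_norm_def by (intro AE_I2 impI order_trans[OF assms(2) abs_ge_self])
qed

text \<open>Radial retraction onto the ball of radius k. It is continuous, unlike a cutoff by an
  indicator, so it turns continuous approximants into bounded continuous ones.\<close>

definition clip :: "real \<Rightarrow> 'b::real_normed_vector \<Rightarrow> 'b" where
  "clip k x = (k / max k (norm x)) *\<^sub>R x"

lemma norm_clip_le: "0 < k \<Longrightarrow> norm (clip k x) \<le> k" "0 < k \<Longrightarrow> norm (clip k x) \<le> norm x"
proof -
  assume k: "0 < k"
  have n: "norm (clip k x) = k / max k (norm x) * norm x" using k by (simp add: clip_def)
  show "norm (clip k x) \<le> k" using k by (simp add: n field_simps max_def)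
  show "norm (clip k x) \<le> norm x" using k by (simp add: n field_simps max_def mult_right_mono)
qed

lemma clip_eq: "norm x \<le> k \<Longrightarrow> 0 < k \<Longrightarrow> clip k x = x"
  by (simp add: clip_def max_def)

lemma continuous_on_clip: "0 < k \<Longrightarrow> continuous_on S (clip k)"
  unfolding clip_def by (intro continuous_intros) auto

text \<open>Here \<open>E\<close> is the open loop flow of \<open>A\<close>, which may grow; it is
  used on finite horizons only.\<close>

locale linear_system =
  fixes A :: "complex^'n^'n" and B :: "complex^'m^'n" and E :: "real \<Rightarrow> complex^'n^'n"
    and M :: "complex^('n + 'm)^('n + 'm)"
  assumes flow: "matrix_flow A E"
begin

sublocale matrix_flow A E by (rule flow)

definition prim :: "(real \<Rightarrow> complex^'m) \<Rightarrow> real \<Rightarrow> complex^'n" where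
  "prim u t = integral {0..t} (\<lambda>s. B *v u s)"

text \<open>An explicit formula for the state, needed to take limits in the input; the chosen
  \<open>state\<close> offers none.\<close>

definition traj :: "(real \<Rightarrow> complex^'m) \<Rightarrow> real \<Rightarrow> complex^'n" where
  "traj u = response (prim u)"

context
  fixes u :: "real \<Rightarrow> complex^'m"
  assumes u: "\<And>t. 0 \<le> t \<Longrightarrow> set_integrable lebesgue {0..t} u"
begin

lemma input_integrable: "0 \<le> t \<Longrightarrow> set_integrable lebesgue {0..t} (\<lambda>s. B *v u s)"
  by (intro set_integrable_bounded_linear[OF bounded_linear_matrix_vector] u)

lemma prim_eq: "0 \<le> t \<Longrightarrow> prim u t = (LINT s:{0..t}|lebesgue. B *v u s)"
  using set_lebesgue_integral_eq_integral(2)[OF input_integrable] by (simp add: prim_def)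

lemma prim_continuous: "0 \<le> t \<Longrightarrow> continuous_on {0..t} (prim u)"
  by (rule response_solution(1)[OF input_integrable]) (simp_all add: prim_def)

lemma traj_continuous: "continuous_on {0..} (traj u)"
  unfolding traj_def
  by (rule continuous_on_atLeast, rule response_solution(2)[OF input_integrable]) (simp_all add: prim_def)

lemma traj_is_solution: "is_solution A B 0 u (traj u)"
  unfolding is_solution_def traj_def
  using response_solution(3,4)[OF input_integrable prim_def] by simp

end

text \<open>A dissipation inequality: at most K |x(T)|^2 can be extracted up to time T from the zero
  state. Unlike nonnegativity of the total cost it involves a finite horizon, so it survives
  dominated limits without any question of admissibility.\<close>

definition dissipative :: "real \<Rightarrow> real \<Rightarrow> (real \<Rightarrow> complex^'m) \<Rightarrow> bool" where
  "dissipative K T u \<longleftrightarrow>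
     0 \<le> Re (LINT t:{0..<T}|lebesgue. cquad M (vstack (traj u t) (u t))) + K * (norm (traj u T))\<^sup>2"

text \<open>Convergence passes from inputs to \<open>prim\<close>, from there to
  \<open>traj\<close>, and finally to the cost, by dominated convergence each time. Integrability of
  w controls the states uniformly, that of its square controls the cost.\<close>

lemma dissipative_limit:
  fixes v :: "nat \<Rightarrow> real \<Rightarrow> complex^'m"
  assumes v: "\<And>n. v n \<in> borel_measurable lebesgue" and u: "u \<in> borel_measurable lebesgue"
    and lim: "AE t in lebesgue. (\<lambda>n. v n t) \<longlonglongrightarrow> u t"
    and vw: "\<And>n t. norm (v n t) \<le> w t" and uw: "\<And>t. norm (u t) \<le> w t"
    and w: "\<And>t. 0 \<le> t \<Longrightarrow> set_integrable lebesgue {0..t} w"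
    and w2: "\<And>t. 0 \<le> t \<Longrightarrow> set_integrable lebesgue {0..t} (\<lambda>s. (w s)\<^sup>2)"
    and T: "0 < T" and d: "\<And>n. dissipative K T (v n)"
  shows "dissipative K T u"
proof -
  have ui: "set_integrable lebesgue {0..t} u" if "0 \<le> t" for t
    by (rule bounded_imp_set_integrable[OF u uw w[OF that]])
  have vi: "set_integrable lebesgue {0..t} (v n)" if "0 \<le> t" for n t
    by (rule bounded_imp_set_integrable[OF v vw w[OF that]])
  obtain KB where KB: "KB > 0" "\<And>x. norm (B *v x) \<le> norm x * KB"
    using bounded_linear.pos_bounded[OF bounded_linear_matrix_vector] by blast
  obtain KA where KA: "KA > 0" "\<And>x. norm (A *v x) \<le> norm x * KA"
    using bounded_linear.pos_bounded[OF bounded_linear_matrix_vector] by blast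
  obtain KE where KE: "KE > 0" "\<And>X (x :: complex^'n). norm ((X :: complex^'n^'n) *v x) \<le> norm X * norm x * KE"
    using bounded_bilinear.pos_bounded[OF bounded_bilinear_matrix_vector] by blast
  have "bounded (E ` {-T..T})"
    by (intro compact_imp_bounded compact_continuous_image continuous_on_E) auto
  then obtain L where L: "L > 0" "\<And>t. t \<in> {-T..T} \<Longrightarrow> norm (E t) \<le> L"
    unfolding bounded_pos by auto
  \<comment> \<open>\<open>H\<close> bounds the primitive, \<open>G\<close> the integrand E(-s) A
    prim(s), and \<open>X\<close> the state, on [0, T] and for every input dominated by w.\<close>
  define H where "H = (LINT s:{0..T}|lebesgue. w s) * KB"
  define G where "G = L * (H * KA) * KE"
  define X where "X = H + L * (G * T) * KE"
  have w0: "0 \<le> w t" for t using order_trans[OF norm_ge_zero uw] .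
  have H0: "0 \<le> H"
    unfolding H_def set_lebesgue_integral_def using KB(1) w0
    by (intro mult_nonneg_nonneg Bochner_Integration.integral_nonneg) auto
  have prim_lim: "(\<lambda>n. prim (v n) t) \<longlonglongrightarrow> prim u t" if t: "t \<in> {0..T}" for t
  proof -
    have "(\<lambda>n. LINT s|lebesgue. indicator {0..t} s *\<^sub>R (B *v v n s)) \<longlonglongrightarrow> (LINT s|lebesgue. indicator {0..t} s *\<^sub>R (B *v u s))"
    proof (rule integral_dominated_convergence)
      show "integrable lebesgue (\<lambda>s. (indicator {0..t} s *\<^sub>R w s) * KB)"
        using w[of t] t by (simp add: set_integrable_def)
      show "(\<lambda>s. indicator {0..t} s *\<^sub>R (B *v u s)) \<in> borel_measurable lebesgue"
        using input_integrable[OF ui, of t] t by (auto simp: set_integrable_def)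
      show "(\<lambda>s. indicator {0..t} s *\<^sub>R (B *v v n s)) \<in> borel_measurable lebesgue" for n
        using input_integrable[OF vi, of t] t by (auto simp: set_integrable_def)
      show "AE s in lebesgue. (\<lambda>n. indicator {0..t} s *\<^sub>R (B *v v n s)) \<longlonglongrightarrow> indicator {0..t} s *\<^sub>R (B *v u s)"
        using lim by eventually_elim
          (rule tendsto_scaleR[OF tendsto_const bounded_linear.tendsto[OF bounded_linear_matrix_vector]])
      show "AE s in lebesgue. norm (indicator {0..t} s *\<^sub>R (B *v v n s)) \<le> (indicator {0..t} s *\<^sub>R w s) * KB" for n
      proof (rule AE_I2)
        fix s
        have "norm (B *v v n s) \<le> w s * KB"
          using KB(1) vw by (intro order_trans[OF KB(2)] mult_right_mono) auto
        then show "norm (indicator {0..t} s *\<^sub>R (B *v v n s)) \<le> (indicator {0..t} s *\<^sub>R w s) * KB"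
          by (simp add: indicator_def)
      qed
    qed
    then show ?thesis
      using t by (simp add: prim_eq[OF vi] prim_eq[OF ui] set_lebesgue_integral_def)
  qed
  have prim_bound: "norm (prim y t) \<le> H"
    if t: "t \<in> {0..T}" and y: "y \<in> borel_measurable lebesgue" "\<And>t. norm (y t) \<le> w t" for y t
  proof -
    have yi: "set_integrable lebesgue {0..t} y" if "0 \<le> t" for t
      by (rule bounded_imp_set_integrable[OF y w[OF that]])
    have "norm (prim y t) \<le> (LINT s:{0..t}|lebesgue. norm (B *v y s))"
      using t set_integral_norm_bound[OF input_integrable[OF yi, of t]] by (simp add: prim_eq[OF yi])
    also have "\<dots> \<le> (LINT s:{0..T}|lebesgue. w s * KB)"
      unfolding set_lebesgue_integral_def
    proof (rule integral_mono')
      show "integrable lebesgue (\<lambda>s. indicator {0..T} s *\<^sub>R (w s * KB))"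
        using w[of T] T by (simp add: set_integrable_def flip: mult.assoc)
      fix s
      have "norm (B *v y s) \<le> w s * KB"
        using KB(1) y(2) by (intro order_trans[OF KB(2)] mult_right_mono) auto
      then show "indicator {0..t} s *\<^sub>R norm (B *v y s) \<le> indicator {0..T} s *\<^sub>R (w s * KB)"
        using t w0 KB(1) by (auto simp: indicator_def)
      show "0 \<le> indicator {0..T} s *\<^sub>R (w s * KB)"
        using w0 KB(1) by (auto simp: indicator_def)
    qed
    also have "\<dots> = H" by (simp add: H_def)
    finally show ?thesis .
  qed
  have kernel_bound: "norm (E (- s) *v (A *v prim y s)) \<le> G"
    if s: "s \<in> {0..T}" and y: "y \<in> borel_measurable lebesgue" "\<And>t. norm (y t) \<le> w t" for y s
  proof -
    have "norm (E (- s) *v (A *v prim y s)) \<le> norm (E (- s)) * norm (A *v prim y s) * KE" by (rule KE)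
    also have "\<dots> \<le> L * (H * KA) * KE"
    proof (intro mult_mono)
      show "norm (A *v prim y s) \<le> H * KA"
        using KA(1) prim_bound[OF s y] by (intro order_trans[OF KA(2)] mult_right_mono) auto
    qed (use L KE KA s H0 in auto)
    finally show ?thesis by (simp add: G_def)
  qed
  have kernel_cont: "continuous_on {0..t} (\<lambda>s. E (- s) *v (A *v prim y s))"
    if "0 \<le> t" and y: "y \<in> borel_measurable lebesgue" "\<And>t. norm (y t) \<le> w t" for y t
    by (intro continuous_intros prim_continuous bounded_imp_set_integrable[OF y] w that)
  have G0: "0 \<le> G"
    using L(1) KE(1) KA(1) H0 by (simp add: G_def)
  have traj_bound: "norm (traj y t) \<le> X"
    if t: "t \<in> {0..T}" and y: "y \<in> borel_measurable lebesgue" "\<And>t. norm (y t) \<le> w t" for y t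
  proof -
    define g where "g = integral {0..t} (\<lambda>s. E (- s) *v (A *v prim y s))"
    have "norm g \<le> G * (t - 0)"
      unfolding g_def by (rule integral_bound) (use t kernel_bound y in \<open>auto intro!: kernel_cont\<close>)
    also have "\<dots> \<le> G * T" using t G0 by (intro mult_left_mono) auto
    finally have g: "norm g \<le> G * T" .
    have "norm (E t *v g) \<le> norm (E t) * norm g * KE" by (rule KE)
    also have "\<dots> \<le> L * (G * T) * KE"
      using L KE t g T G0 by (intro mult_mono) auto
    finally have "norm (E t *v g) \<le> L * (G * T) * KE" .
    with prim_bound[OF t y] show ?thesis
      unfolding traj_def response_def X_def g_def[symmetric] by (rule norm_triangle_mono)
  qed
  have traj_lim: "(\<lambda>n. traj (v n) t) \<longlonglongrightarrow> traj u t" if t: "t \<in> {0..T}" for t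
  proof -
    have "(\<lambda>n. integral {0..t} (\<lambda>s. E (- s) *v (A *v prim (v n) s))) \<longlonglongrightarrow> integral {0..t} (\<lambda>s. E (- s) *v (A *v prim u s))"
    proof (rule dominated_convergence(2)[of _ _ "\<lambda>s. G"])
      show "(\<lambda>s. E (- s) *v (A *v prim (v n) s)) integrable_on {0..t}" for n
        using t by (intro integrable_continuous_interval kernel_cont v vw) auto
      show "norm (E (- s) *v (A *v prim (v n) s)) \<le> G" if "s \<in> {0..t}" for n s
        using t that by (intro kernel_bound v vw) auto
      show "(\<lambda>n. E (- s) *v (A *v prim (v n) s)) \<longlonglongrightarrow> E (- s) *v (A *v prim u s)" if "s \<in> {0..t}" for s
        using t that by (intro bounded_linear.tendsto[OF bounded_linear_matrix_vector] prim_lim) auto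
    qed auto
    then show ?thesis
      unfolding traj_def response_def
      by (intro tendsto_add prim_lim t bounded_linear.tendsto[OF bounded_linear_matrix_vector])
  qed
  obtain KQ where KQ: "KQ > 0" "\<And>z. norm (cquad M z) \<le> KQ * (norm z)\<^sup>2"
    by (rule cquad_bound) (rule that)
  define q where "q y t = indicator {0..<T} t *\<^sub>R cquad M (vstack (traj y t) (y t))" for y t
  have qm: "q y \<in> borel_measurable lebesgue" if y: "y \<in> borel_measurable lebesgue" "\<And>t. norm (y t) \<le> w t" for y
  proof -
    \<comment> \<open>Continuity of \<open>traj\<close> is known for t \<ge> 0 only. Freezing it
      before 0 gives a measurable function on the line and leaves \<open>q\<close> unchanged because
      of the indicator.\<close>
    have "continuous_on UNIV (\<lambda>t. traj y (max 0 t))"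
      by (rule continuous_on_compose2[OF traj_continuous[OF bounded_imp_set_integrable[OF y w]]])
         (auto intro!: continuous_intros)
    from borel_measurable_cquad_vstack[OF continuous_imp_lebesgue_measurable[OF this] y(1)]
    have "(\<lambda>t. indicator {0..<T} t *\<^sub>R cquad M (vstack (traj y (max 0 t)) (y t))) \<in> borel_measurable lebesgue"
      by (intro borel_measurable_scaleR borel_measurable_indicator) auto
    moreover have "(\<lambda>t. indicator {0..<T} t *\<^sub>R cquad M (vstack (traj y (max 0 t)) (y t))) = q y"
      by (auto simp: q_def fun_eq_iff indicator_def)
    ultimately show ?thesis by (simp only:)
  qed
  have "(\<lambda>n. LINT t|lebesgue. q (v n) t) \<longlonglongrightarrow> (LINT t|lebesgue. q u t)"
  proof (rule integral_dominated_convergence)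
    have "set_integrable lebesgue {0..T} (\<lambda>t. KQ * (X\<^sup>2 + (w t)\<^sup>2))"
      using T by (intro set_integrable_mult_right set_integral_add(1) w2 absolutely_integrable_continuous_real continuous_intros) auto
    then show "integrable lebesgue (\<lambda>t. indicator {0..T} t *\<^sub>R (KQ * (X\<^sup>2 + (w t)\<^sup>2)))"
      by (simp add: set_integrable_def)
    show "q u \<in> borel_measurable lebesgue" by (rule qm[OF u uw])
    show "q (v n) \<in> borel_measurable lebesgue" for n by (rule qm[OF v vw])
    show "AE t in lebesgue. (\<lambda>n. q (v n) t) \<longlonglongrightarrow> q u t"
      using lim
    proof eventually_elim
      case (elim t)
      show ?case
      proof (cases "t \<in> {0..<T}")
        case True
        have tup: "(\<lambda>n. (traj (v n) t, v n t)) \<longlonglongrightarrow> (traj u t, u t)"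
          using True by (intro tendsto_Pair traj_lim elim) auto
        have cont: "continuous_on UNIV (\<lambda>p. cquad M (vstack (fst p :: complex^'n) (snd p :: complex^'m)))"
          by (intro continuous_intros)
        from continuous_on_tendsto_compose[OF cont tup]
        have "(\<lambda>n. cquad M (vstack (traj (v n) t) (v n t))) \<longlonglongrightarrow> cquad M (vstack (traj u t) (u t))"
          by simp
        then show ?thesis using True by (simp add: q_def)
      qed (simp add: q_def)
    qed
    show "AE t in lebesgue. norm (q (v n) t) \<le> indicator {0..T} t *\<^sub>R (KQ * (X\<^sup>2 + (w t)\<^sup>2))" for n
    proof (rule AE_I2)
      fix t
      show "norm (q (v n) t) \<le> indicator {0..T} t *\<^sub>R (KQ * (X\<^sup>2 + (w t)\<^sup>2))"
      proof (cases "t \<in> {0..<T}")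
        case True
        have "norm (cquad M (vstack (traj (v n) t) (v n t))) \<le> KQ * (norm (vstack (traj (v n) t) (v n t)))\<^sup>2"
          by (rule KQ)
        also have "\<dots> \<le> KQ * (X\<^sup>2 + (w t)\<^sup>2)"
          unfolding norm_vstack using KQ(1) True
          by (intro mult_left_mono add_mono power_mono traj_bound v vw) auto
        finally show ?thesis using True by (simp add: q_def)
      next
        case False
        then show ?thesis using KQ(1) by (simp add: q_def indicator_def)
      qed
    qed
  qed
  then have lim_cost: "(\<lambda>n. LINT t:{0..<T}|lebesgue. cquad M (vstack (traj (v n) t) (v n t)))
      \<longlonglongrightarrow> (LINT t:{0..<T}|lebesgue. cquad M (vstack (traj u t) (u t)))"
    by (simp add: q_def set_lebesgue_integral_def)
  have "(\<lambda>n. Re (LINT t:{0..<T}|lebesgue. cquad M (vstack (traj (v n) t) (v n t))) + K * (norm (traj (v n) T))\<^sup>2)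
    \<longlonglongrightarrow> Re (LINT t:{0..<T}|lebesgue. cquad M (vstack (traj u t) (u t))) + K * (norm (traj u T))\<^sup>2"
    using T by (intro tendsto_intros lim_cost traj_lim) auto
  then show ?thesis
    unfolding dissipative_def
    by (rule LIMSEQ_le_const) (use d in \<open>auto simp: dissipative_def\<close>)
qed

text \<open>Two limits, as the continuous functions approximating a measurable one almost everywhere
  come without domination. If \<open>y\<close> is bounded by k, clipping them at k supplies it; a
  general input is the limit of its own truncations, dominated by |u|.\<close>

lemma dissipative_extend:
  assumes cont: "\<And>u. continuous_on UNIV u \<Longrightarrow> dissipative K T u"
    and T: "0 < T" and u: "u \<in> borel_measurable lebesgue"
    and u2: "\<And>t. 0 \<le> t \<Longrightarrow> set_integrable lebesgue {0..t} u"
      "\<And>t. 0 \<le> t \<Longrightarrow> set_integrable lebesgue {0..t} (\<lambda>s. (norm (u s))\<^sup>2)"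
  shows "dissipative K T u"
proof -
  have bounded: "dissipative K T y"
    if y: "y \<in> borel_measurable lebesgue" and yk: "\<And>t. norm (y t) \<le> k" and k: "0 < k" for y k
  proof -
    have "y measurable_on UNIV" using y by (intro lebesgue_measurable_imp_measurable_on) auto
    then obtain N g where N: "negligible N" and g: "\<And>n. continuous_on UNIV (g n)"
      and lim: "\<And>t. t \<notin> N \<Longrightarrow> (\<lambda>n. g n t) \<longlonglongrightarrow> y t"
      unfolding measurable_on_def by auto
    have gc: "continuous_on UNIV (\<lambda>t. clip k (g n t))" for n
      by (rule continuous_on_compose2[OF continuous_on_clip[OF k, of UNIV] g]) auto
    show ?thesis
    proof (rule dissipative_limit[of "\<lambda>n t. clip k (g n t)" _ "\<lambda>t. k"])
      show "(\<lambda>t. clip k (g n t)) \<in> borel_measurable lebesgue" for n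
        by (rule continuous_imp_lebesgue_measurable[OF gc])
      have "AE t in lebesgue. t \<notin> N"
        using N by (intro AE_not_in) (simp add: negligible_iff_null_sets)
      then show "AE t in lebesgue. (\<lambda>n. clip k (g n t)) \<longlonglongrightarrow> y t"
      proof eventually_elim
        case (elim t)
        have "(\<lambda>n. clip k (g n t)) \<longlonglongrightarrow> clip k (y t)"
          by (rule continuous_on_tendsto_compose[OF continuous_on_clip[OF k, of UNIV] lim[OF elim]]) auto
        then show ?case by (simp add: clip_eq yk k)
      qed
    qed (use y yk k T in \<open>auto intro!: norm_clip_le cont gc absolutely_integrable_continuous_real continuous_intros\<close>)
  qed
  show ?thesis
  proof (rule dissipative_limit[of "\<lambda>n t. clip (real (Suc n)) (u t)" _ "\<lambda>t. norm (u t)"])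
    show m: "(\<lambda>t. clip (real (Suc n)) (u t)) \<in> borel_measurable lebesgue" for n
      by (rule measurable_compose[OF u borel_measurable_continuous_onI[OF continuous_on_clip]]) simp
    show "AE t in lebesgue. (\<lambda>n. clip (real (Suc n)) (u t)) \<longlonglongrightarrow> u t"
    proof (rule AE_I2)
      fix t
      obtain N :: nat where N: "norm (u t) \<le> real N" using real_arch_simple by blast
      have "\<forall>\<^sub>F n in sequentially. clip (real (Suc n)) (u t) = u t"
        using eventually_ge_at_top[of N] by eventually_elim (use N in \<open>auto intro!: clip_eq\<close>)
      then show "(\<lambda>n. clip (real (Suc n)) (u t)) \<longlonglongrightarrow> u t"
        by (rule tendsto_eventually)
    qed
    show "dissipative K T (\<lambda>t. clip (real (Suc n)) (u t))" for n
      by (rule bounded[OF m, where k = "real (Suc n)"]) (auto intro!: norm_clip_le)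
    show "norm (clip (real (Suc n)) (u t)) \<le> norm (u t)" for n t
      by (rule norm_clip_le) simp
  qed (use u u2 T in \<open>auto intro: set_integrable_norm\<close>)
qed

end

subsection \<open>The equivalence\<close>

lemma is_solution_cong:
  assumes "is_solution A B x0 u x" "\<And>t. 0 \<le> t \<Longrightarrow> u t = v t"
  shows "is_solution A B x0 v x"
proof -
  have eq: "(\<lambda>s. indicator {0..t} s *\<^sub>R (A *v x s + B *v u s)) = (\<lambda>s. indicator {0..t} s *\<^sub>R (A *v x s + B *v v s))" for t
    using assms(2) by (auto simp: indicator_def fun_eq_iff)
  show ?thesis
    using assms(1) by (simp add: is_solution_def set_integrable_def set_lebesgue_integral_def eq)
qed

lemma L2_Rplus_cong:
  assumes "f \<in> L2_Rplus" "\<And>t. 0 \<le> t \<Longrightarrow> f t = g t"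
  shows "g \<in> L2_Rplus"
proof -
  have "(\<lambda>t. indicator {0..} t *\<^sub>R f t) = (\<lambda>t. indicator {0..} t *\<^sub>R g t)"
    "(\<lambda>t. indicator {0..} t *\<^sub>R (norm (f t))\<^sup>2) = (\<lambda>t. indicator {0..} t *\<^sub>R (norm (g t))\<^sup>2)"
    using assms(2) by (auto simp: indicator_def fun_eq_iff)
  then show ?thesis
    using assms(1) by (simp add: L2_Rplus_def set_integrable_def set_borel_measurable_def)
qed

text \<open>An integrable nonnegative function need not tend to zero, but it is smaller than any
  given \<delta> at arbitrarily late times; this is all that is needed of |x|^2.\<close>

lemma not_eventually_bounded_below:
  fixes f :: "real \<Rightarrow> real"
  assumes f: "set_integrable lebesgue {0..} f" and f0: "\<And>t. 0 \<le> f t" and \<delta>: "0 < \<delta>"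
  shows "\<not> (\<forall>\<^sub>F t in at_top. \<delta> \<le> f t)"
proof
  assume "\<forall>\<^sub>F t in at_top. \<delta> \<le> f t"
  then obtain N' where N': "\<And>t. N' \<le> t \<Longrightarrow> \<delta> \<le> f t"
    by (auto simp: eventually_at_top_linorder)
  define N where "N = max 0 N'"
  have N: "0 \<le> N" "\<And>t. N \<le> t \<Longrightarrow> \<delta> \<le> f t" using N' by (auto simp: N_def)
  define I where "I = (LINT t:{0..}|lebesgue. f t)"
  have "\<delta> * m \<le> I" if m: "0 \<le> m" for m
  proof -
    have ci: "set_integrable lebesgue {N..N + m} (\<lambda>t. \<delta>)"
      by (intro absolutely_integrable_continuous_real continuous_intros)
    have fi: "set_integrable lebesgue {N..N + m} f"
      by (rule set_integrable_subset[OF f]) (use N in auto)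
    have "\<delta> * m = (LINT t:{N..N + m}|lebesgue. \<delta>)"
      using m by (simp add: set_lebesgue_integral_eq_integral(2)[OF ci])
    also have "\<dots> \<le> (LINT t:{N..N + m}|lebesgue. f t)"
      by (rule set_integral_mono[OF ci fi]) (use N in auto)
    also have "\<dots> \<le> I"
      unfolding I_def set_lebesgue_integral_def
      by (rule integral_mono') (use f f0 N(1) in \<open>auto simp: set_integrable_def indicator_def\<close>)
    finally show ?thesis .
  qed
  \<comment> \<open>For this length the lower bound is |I| + 1, more than the whole
    integral.\<close>
  from this[of "(\<bar>I\<bar> + 1) / \<delta>"] \<delta> show False by simp
qed

text \<open>The order on \<open>complex\<close> also demands a vanishing imaginary part; it vanishes
  already in the integrand because \<open>M\<close> is Hermitian.\<close>

lemma cost_real: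
  assumes "conj_transpose M = M"
  shows "cost A B M x0 u = of_real (Re (cost A B M x0 u))"
proof -
  have q: "cquad M v = of_real (Re (cquad M v))" for v
    using Im_cquad_hermitian[OF assms] by (simp add: complex_eq_iff)
  have "cost A B M x0 u = (LINT t|lebesgue. complex_of_real (indicator {0..} t * Re (cquad M (vstack (state A B x0 u t) (u t)))))"
    unfolding cost_def set_lebesgue_integral_def
    by (intro Bochner_Integration.integral_cong) (simp_all add: scaleR_conv_of_real flip: q)
  then show ?thesis
    by (simp only: integral_complex_of_real) simp
qed

lemma popov_imp_cost_nonneg:
  fixes A :: "complex^'n^'n" and B :: "complex^'m^'n" and M :: "complex^('n + 'm)^('n + 'm)"
  assumes stab: "stabilizable A B" and M: "conj_transpose M = M"
    and popov: "\<And>\<omega>. \<i> * of_real \<omega> \<notin> spectrum A \<Longrightarrow> pos_semidef (popov A B M \<omega>)"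
    and u: "u \<in> admissible_inputs A B"
  shows "0 \<le> cost A B M 0 u"
proof -
  obtain F E c D where "matrix_flow (A + B ** F) E" "c > 0" "\<And>t. 0 \<le> t \<Longrightarrow> norm (E t) \<le> D * exp (- c * t)"
    using stabilizable_imp_decay[OF stab] by metis
  then interpret S: stabilized_system A B F E c D M
    by (rule stabilized_system.intro)
  obtain EA where "matrix_flow A EA" using matrix_flow_exists by blast
  then interpret Y: linear_system A B EA M by (rule linear_system.intro)
  obtain K where K: "K > 0" and tail: "\<And>T x u. 0 < T \<Longrightarrow> continuous_on UNIV x \<Longrightarrow> continuous_on UNIV u \<Longrightarrow>
     norm ((LINT t:{0..}|lebesgue. cquad M (S.ext T x u t)) - (LINT t:{0..<T}|lebesgue. cquad M (vstack (x t) (u t))))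
       \<le> K * (norm (x T))\<^sup>2"
    by (rule S.ext_cost_tail) (rule that)
  have cont: "Y.dissipative K T y" if yc: "continuous_on UNIV y" and T: "0 < T" for y T
  proof -
    have yi: "set_integrable lebesgue {0..t} y" for t
      by (intro absolutely_integrable_continuous_real continuous_on_subset[OF yc]) auto
    \<comment> \<open>The continuation lemmas ask for continuity on the whole line, hence the
      constant extension to negative times.\<close>
    define x where "x t = Y.traj y (max 0 t)" for t
    have xe: "x t = Y.traj y t" if "0 \<le> t" for t using that by (simp add: x_def)
    have xc: "continuous_on UNIV x"
      unfolding x_def by (rule continuous_on_compose2[OF Y.traj_continuous[OF yi]]) (auto intro!: continuous_intros)
    have rc: "continuous_on V (\<lambda>s. A *v x s + B *v y s)" for V
      by (intro continuous_intros continuous_on_subset[OF xc] continuous_on_subset[OF yc]) auto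
    have x_int: "x t = integral {0..t} (\<lambda>s. A *v x s + B *v y s)" if t: "0 \<le> t" for t
    proof -
      have "x t = (LINT s:{0..t}|lebesgue. A *v Y.traj y s + B *v y s)"
        using Y.traj_is_solution[OF yi] t by (simp add: is_solution_def xe)
      also have "\<dots> = (LINT s:{0..t}|lebesgue. A *v x s + B *v y s)"
        unfolding set_lebesgue_integral_def
        by (intro Bochner_Integration.integral_cong) (auto simp: indicator_def xe)
      also have "\<dots> = integral {0..t} (\<lambda>s. A *v x s + B *v y s)"
        by (intro set_lebesgue_integral_eq_integral(2) absolutely_integrable_continuous_real rc)
      finally show ?thesis .
    qed
    have d: "(x has_vector_derivative (A *v x t + B *v y t)) (at t)" if t: "0 < t" "t < T" for t
    proof -
      have "((\<lambda>t. integral {0..t} (\<lambda>s. A *v x s + B *v y s)) has_vector_derivative (A *v x t + B *v y t)) (at t within {0..T})"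
        by (rule integral_has_vector_derivative[OF rc]) (use t in auto)
      then have "((\<lambda>t. integral {0..t} (\<lambda>s. A *v x s + B *v y s)) has_vector_derivative (A *v x t + B *v y t)) (at t)"
        using t by (simp add: at_within_Icc_at)
      then show ?thesis
        by (rule has_vector_derivative_transform_within_open[of _ _ _ "{0<..}"])
           (use t in \<open>auto intro: x_int[symmetric]\<close>)
    qed
    have "0 \<le> Re (LINT t:{0..}|lebesgue. cquad M (S.ext T x y t))"
      by (rule S.cost_ext_nonneg[OF T xc yc d _ popov]) (use x_int[of 0] in auto)
    moreover have "\<bar>Re ((LINT t:{0..}|lebesgue. cquad M (S.ext T x y t)) - (LINT t:{0..<T}|lebesgue. cquad M (vstack (x t) (y t))))\<bar>
        \<le> K * (norm (x T))\<^sup>2"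
      by (rule order_trans[OF abs_Re_le_cmod tail[OF T xc yc]])
    moreover have "(LINT t:{0..<T}|lebesgue. cquad M (vstack (x t) (y t))) = (LINT t:{0..<T}|lebesgue. cquad M (vstack (Y.traj y t) (y t)))"
      unfolding set_lebesgue_integral_def
      by (intro Bochner_Integration.integral_cong) (auto simp: indicator_def xe)
    ultimately show ?thesis
      using T unfolding Y.dissipative_def by (simp add: xe)
  qed
  have uL: "u \<in> L2_Rplus" and xL: "state A B 0 u \<in> L2_Rplus"
    using u by (auto simp: admissible_inputs_def)
  define x where "x = state A B 0 u"
  \<comment> \<open>Membership in \<open>L2_Rplus\<close> gives measurability on the half-line only,
    whereas \<open>dissipative_extend\<close> needs it everywhere.\<close>
  define v where "v t = indicator {0..} t *\<^sub>R u t" for t :: real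
  have vu: "v t = u t" if "0 \<le> t" for t using that by (simp add: v_def)
  have vL: "v \<in> L2_Rplus" by (rule L2_Rplus_cong[OF uL]) (simp add: vu)
  have vm: "v \<in> borel_measurable lebesgue"
    using uL by (simp add: v_def[abs_def] L2_Rplus_def set_borel_measurable_def)
  have vi: "set_integrable lebesgue {0..t} v" for t
    by (rule L2_Rplus_imp_locally_integrable[OF vL]) simp
  have "is_solution A B 0 u (Y.traj v)"
    by (rule is_solution_cong[OF Y.traj_is_solution[OF vi]]) (rule vu)
  then have xv: "x t = Y.traj v t" if "0 \<le> t" for t
    using that unfolding x_def by (rule Y.state_eq)
  have diss: "0 \<le> Re (LINT t:{0..<T}|lebesgue. cquad M (vstack (x t) (u t))) + K * (norm (x T))\<^sup>2" if T: "0 < T" for T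
  proof -
    have "Y.dissipative K T v"
    proof (rule Y.dissipative_extend[OF cont[OF _ T] T vm vi])
      show "set_integrable lebesgue {0..t} (\<lambda>s. (norm (v s))\<^sup>2)" for t
        by (rule set_integrable_subset[of _ "{0..}"]) (use vL in \<open>auto simp: L2_Rplus_def\<close>)
    qed
    moreover have "(LINT t:{0..<T}|lebesgue. cquad M (vstack (Y.traj v t) (v t))) = (LINT t:{0..<T}|lebesgue. cquad M (vstack (x t) (u t)))"
      unfolding set_lebesgue_integral_def
      by (intro Bochner_Integration.integral_cong) (auto simp: indicator_def xv vu)
    ultimately show ?thesis
      using T by (simp add: Y.dissipative_def xv)
  qed
  define f where "f t = cquad M (vstack (x t) (u t))" for t
  have fi: "set_integrable lebesgue {0..} f"
  proof -
    obtain L where L: "L > 0" "\<And>z. norm (cquad M z) \<le> L * (norm z)\<^sup>2"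
      by (rule cquad_bound) (rule that)
    show ?thesis
    proof (rule set_integrable_bound)
      show "set_integrable lebesgue {0..} (\<lambda>t. L * ((norm (x t))\<^sup>2 + (norm (u t))\<^sup>2))"
        using uL xL by (intro set_integrable_mult_right set_integral_add(1)) (auto simp: L2_Rplus_def x_def)
      have "(\<lambda>t. cquad M (vstack (indicator {0..} t *\<^sub>R x t) (indicator {0..} t *\<^sub>R u t))) \<in> borel_measurable lebesgue"
        using uL xL by (intro borel_measurable_cquad_vstack) (auto simp: L2_Rplus_def set_borel_measurable_def x_def)
      moreover have "cquad M (vstack (indicator {0..} t *\<^sub>R x t) (indicator {0..} t *\<^sub>R u t)) = indicator {0..} t *\<^sub>R f t" for t
      proof -
        have "vstack 0 0 = (0 :: complex^('n + 'm))" by (simp add: vec_eq_iff all_Plus)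
        then show ?thesis by (simp add: f_def indicator_def cquad_def)
      qed
      ultimately show "set_borel_measurable lebesgue {0..} f"
        by (simp add: set_borel_measurable_def)
      show "AE t in lebesgue. t \<in> {0..} \<longrightarrow> norm (f t) \<le> norm (L * ((norm (x t))\<^sup>2 + (norm (u t))\<^sup>2))"
        unfolding real_norm_def f_def norm_vstack[symmetric]
        by (intro AE_I2 impI order_trans[OF L(2) abs_ge_self])
    qed
  qed
  have cost_f: "cost A B M 0 u = (LINT t:{0..}|lebesgue. f t)"
    by (simp add: cost_def f_def x_def)
  have "((\<lambda>T. LINT t:{0..T}|lebesgue. f t) \<longlongrightarrow> cost A B M 0 u) at_top"
    unfolding cost_f by (rule tendsto_set_lebesgue_integral_at_top[OF _ fi]) simp
  then have lim: "((\<lambda>T. Re (LINT t:{0..T}|lebesgue. f t)) \<longlongrightarrow> Re (cost A B M 0 u)) at_top"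
    by (rule tendsto_Re)
  have "0 \<le> Re (cost A B M 0 u)"
  proof (rule ccontr)
    assume "\<not> 0 \<le> Re (cost A B M 0 u)"
    \<comment> \<open>Half of the supposed deficit. For all large T the cost up to T is then below
      -\<epsilon>, so \<open>diss\<close> forces K |x(T)|^2 \<ge> \<epsilon> eventually, against the
      integrability of |x|^2.\<close>
    define \<epsilon> where "\<epsilon> = - Re (cost A B M 0 u) / 2"
    have \<epsilon>: "0 < \<epsilon>" "Re (cost A B M 0 u) < - \<epsilon>"
      using \<open>\<not> 0 \<le> Re (cost A B M 0 u)\<close> by (auto simp: \<epsilon>_def)
    have "\<forall>\<^sub>F T in at_top. \<epsilon> / K \<le> (norm (x T))\<^sup>2"
      using order_tendstoD(2)[OF lim \<epsilon>(2)] eventually_gt_at_top[of 0]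
    proof eventually_elim
      case (elim T)
      have i: "set_integrable lebesgue {0..T} f" "set_integrable lebesgue {0..<T} f"
        by (rule set_integrable_subset[OF fi]; auto)+
      \<comment> \<open>The limit theorem yields closed intervals, the switching construction
        half-open ones.\<close>
      have "{0..T} - {0..<T} = {T}" using elim by auto
      then have neg: "negligible ({0..T} - {0..<T})" by simp
      have "(LINT t:{0..<T}|lebesgue. f t) = (LINT t:{0..T}|lebesgue. f t)"
        unfolding set_lebesgue_integral_eq_integral(2)[OF i(1)] set_lebesgue_integral_eq_integral(2)[OF i(2)]
        by (rule integral_subset_negligible[OF _ neg]) auto
      then have "\<epsilon> \<le> K * (norm (x T))\<^sup>2"
        using elim diss[of T] by (simp add: f_def)
      then show ?case using K by (simp add: field_simps)
    qed
    moreover have "set_integrable lebesgue {0..} (\<lambda>t. (norm (x t))\<^sup>2)"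
      using xL by (simp add: L2_Rplus_def x_def)
    ultimately show False
      using not_eventually_bounded_below[of "\<lambda>t. (norm (x t))\<^sup>2" "\<epsilon> / K"] \<epsilon>(1) K by simp
  qed
  then show ?thesis
    by (subst cost_real[OF M]) (simp add: less_eq_complex_def)
qed

lemma cost_nonneg_imp_popov:
  fixes A :: "complex^'n^'n" and B :: "complex^'m^'n" and M :: "complex^('n + 'm)^('n + 'm)"
  assumes stab: "stabilizable A B" and M: "conj_transpose M = M"
    and cost: "\<And>u. u \<in> admissible_inputs A B \<Longrightarrow> 0 \<le> cost A B M 0 u"
    and ns: "\<i> * of_real \<omega> \<notin> spectrum A"
  shows "pos_semidef (popov A B M \<omega>)"
  unfolding pos_semidef_def
proof (intro conjI allI popov_hermitian M)
  fix w :: "complex^'m"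
  obtain F E c D where "matrix_flow (A + B ** F) E" and c: "c > 0" and "\<And>t. 0 \<le> t \<Longrightarrow> norm (E t) \<le> D * exp (- c * t)"
    using stabilizable_imp_decay[OF stab] by metis
  then interpret S: stabilized_system A B F E c D M
    by (rule stabilized_system.intro)
  obtain EA where "matrix_flow A EA" using matrix_flow_exists by blast
  then interpret Y: linear_system A B EA M by (rule linear_system.intro)
  obtain K where K: "K > 0" and tail: "\<And>T x u. 0 < T \<Longrightarrow> continuous_on UNIV x \<Longrightarrow> continuous_on UNIV u \<Longrightarrow>
     norm ((LINT t:{0..}|lebesgue. cquad M (S.ext T x u t)) - (LINT t:{0..<T}|lebesgue. cquad M (vstack (x t) (u t))))
       \<le> K * (norm (x T))\<^sup>2"
    by (rule S.ext_cost_tail) (rule that)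
  define \<xi> where "\<xi> = matrix_inv (mat (\<i> * of_real \<omega>) - A) *v (B *v w)"
  have "(mat (\<i> * of_real \<omega>) - A) *v \<xi> = B *v w"
    unfolding \<xi>_def by (simp add: matrix_vector_mul_assoc matrix_mul_assoc matrix_inv_resolvent(2)[OF ns])
  then have \<xi>: "(\<i> * of_real \<omega>) *s \<xi> = A *v \<xi> + B *v w"
    by (simp add: matrix_vector_mult_diff_rdistrib mat_mult_vector algebra_simps)
  define z where "z = vstack \<xi> w"
  have popov_z: "cquad (popov A B M \<omega>) w = cquad M z"
    unfolding z_def by (rule cquad_popov[OF ns \<xi>])
  define e where "e t = iexp (\<omega> * t)" for t :: real
  \<comment> \<open>The harmonic response minus a transient that enforces \<open>x 0 = 0\<close>.
    The term -F E(t) \<xi> in the input makes this transient follow the closed loop, so it decays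
    even if \<open>A\<close> is unstable.\<close>
  define x where "x t = mat (e t) *v \<xi> - E t *v \<xi>" for t
  define u where "u t = mat (e t) *v w - F *v (E t *v \<xi>)" for t
  define d where "d t = vstack (E t *v \<xi>) (F *v (E t *v \<xi>))" for t
  have e': "(e has_vector_derivative (\<i> * \<omega> * e t)) (at t)" for t
  proof -
    have "e = (\<lambda>t. exp ((\<i> * \<omega>) * complex_of_real t))"
      by (simp add: e_def fun_eq_iff mult_ac)
    then show ?thesis
      by (simp only:) (rule has_vector_derivative_real_field, auto intro!: derivative_eq_intros)
  qed
  have ec: "continuous_on UNIV (\<lambda>t. mat (e t) :: complex^'k^'k)"
    unfolding e_def by (intro bounded_linear.continuous_on[OF bounded_linear_mat] continuous_intros)
  have xc: "continuous_on UNIV x" unfolding x_def by (intro continuous_intros ec)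
  have uc: "continuous_on UNIV u" unfolding u_def by (intro continuous_intros ec)
  have der: "(x has_vector_derivative (A *v x t + B *v u t)) (at t)" for t
  proof -
    have "((\<lambda>t. mat (e t) *v \<xi>) has_vector_derivative (mat (\<i> * \<omega> * e t) *v \<xi>)) (at t)"
      using matrix_vector_has_vector_derivative[OF mat_has_vector_derivative[OF e'] has_vector_derivative_const] by simp
    from has_vector_derivative_diff[OF this S.closed_loop.E_vector_deriv]
    have "(x has_vector_derivative (mat (\<i> * \<omega> * e t) *v \<xi> - (A + B ** F) *v (E t *v \<xi>))) (at t)"
      unfolding x_def .
    moreover have "mat (\<i> * \<omega> * e t) *v \<xi> = A *v (mat (e t) *v \<xi>) + B *v (mat (e t) *v w)"
    proof -
      have "mat (\<i> * \<omega> * e t) *v \<xi> = e t *s ((\<i> * of_real \<omega>) *s \<xi>)"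
        by (simp add: mat_mult_vector vector_smult_assoc mult_ac)
      also have "\<dots> = A *v (e t *s \<xi>) + B *v (e t *s w)"
        unfolding \<xi> by (simp add: vector_add_ldistrib vector_scalar_commute)
      finally show ?thesis by (simp add: mat_mult_vector)
    qed
    moreover have "(A + B ** F) *v (E t *v \<xi>) = A *v (E t *v \<xi>) + B *v (F *v (E t *v \<xi>))"
      by (simp add: matrix_vector_mult_add_rdistrib flip: matrix_vector_mul_assoc)
    ultimately show ?thesis
      by (simp add: x_def u_def matrix_vector_mult_diff_distrib algebra_simps)
  qed
  have x0: "x 0 = 0" by (simp add: x_def e_def S.closed_loop.E_0)
  obtain K1 where K1: "K1 > 0" "\<And>t \<xi>. 0 \<le> t \<Longrightarrow> norm (E t *v \<xi>) \<le> K1 * norm \<xi> * exp (- c * t)"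
    "\<And>t \<xi>. 0 \<le> t \<Longrightarrow> norm (F *v (E t *v \<xi>)) \<le> K1 * norm \<xi> * exp (- c * t)"
    by (rule S.feedback_bound) (rule that)
  obtain KS where KS: "KS > 0" "\<And>a b. norm (sesq M a b) \<le> norm a * norm b * KS"
    using bounded_bilinear.pos_bounded[OF bounded_bilinear_sesq[of M]] by blast
  define P where "P = 2 * K1 * norm \<xi>"
  have P0: "0 \<le> P" using K1(1) by (simp add: P_def)
  have d_bound: "norm (d t) \<le> P * exp (- c * t)" if "0 \<le> t" for t
  proof -
    have "norm (d t) \<le> norm (E t *v \<xi>) + norm (F *v (E t *v \<xi>))"
      unfolding d_def by (rule norm_vstack_le)
    also have "\<dots> \<le> K1 * norm \<xi> * exp (- c * t) + K1 * norm \<xi> * exp (- c * t)"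
      by (intro add_mono K1 that)
    finally show ?thesis by (simp add: P_def)
  qed
  \<comment> \<open>The cross terms contribute 2 |z| |d| and the transient |d|^2, with |d| bounded
    by P exp (-c t); in the square one exponential is estimated by 1, which leaves the single rate c
    and the integral R / c.\<close>
  define R where "R = KS * (2 * norm z * P + P * P)"
  have R0: "0 \<le> R" using KS(1) P0 by (simp add: R_def)
  \<comment> \<open>The factor 1 lets \<open>sesq_scale\<close> apply to all four terms of the
    expansion. As |e(t)| = 1, the harmonic part contributes the constant
    \<open>cquad M z\<close>.\<close>
  have xu: "vstack (x t) (u t) = e t *s z - 1 *s d t" for t
    by (simp add: x_def u_def d_def z_def vstack_diff mat_mult_vector vstack_scale)
  have en: "norm (e t) = 1" "cnj (e t) * e t = 1" for t
    by (simp_all add: e_def exp_cnj flip: exp_add)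
  have q_le: "Re (cquad M (vstack (x t) (u t))) \<le> Re (cquad M z) + R * exp (- c * t)" if t: "0 \<le> t" for t
  proof -
    interpret q: bounded_bilinear "sesq M" by (rule bounded_bilinear_sesq)
    have "cquad M (vstack (x t) (u t)) = sesq M (e t *s z) (e t *s z) - sesq M (e t *s z) (1 *s d t)
        - sesq M (1 *s d t) (e t *s z) + sesq M (1 *s d t) (1 *s d t)"
      unfolding xu cquad_eq_sesq by (simp only: q.diff_left q.diff_right) simp
    also have "\<dots> = cquad M z + (sesq M (d t) (d t) - cnj (e t) * sesq M z (d t) - e t * sesq M (d t) z)"
      unfolding sesq_scale cquad_eq_sesq by (simp add: en)
    finally have eq: "cquad M (vstack (x t) (u t)) = cquad M z + (sesq M (d t) (d t) - cnj (e t) * sesq M z (d t) - e t * sesq M (d t) z)" .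
    have "norm (sesq M (d t) (d t) - cnj (e t) * sesq M z (d t) - e t * sesq M (d t) z)
      \<le> norm (sesq M (d t) (d t)) + norm (cnj (e t) * sesq M z (d t)) + norm (e t * sesq M (d t) z)"
      by (rule order_trans[OF norm_triangle_ineq4 add_right_mono[OF norm_triangle_ineq4]])
    also have "\<dots> \<le> norm (d t) * norm (d t) * KS + norm z * norm (d t) * KS + norm (d t) * norm z * KS"
      unfolding norm_mult complex_mod_cnj en mult_1_left by (intro add_mono KS)
    also have "\<dots> = KS * (2 * norm z + norm (d t)) * norm (d t)" by (simp add: algebra_simps)
    also have "\<dots> \<le> KS * (2 * norm z + P) * (P * exp (- c * t))"
    proof (intro mult_mono d_bound t order_refl add_mono)
      have "P * exp (- c * t) \<le> P" using P0 t c by (simp add: mult_left_le)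
      then show "norm (d t) \<le> P" using d_bound[OF t] by simp
    qed (use KS(1) P0 in auto)
    also have "\<dots> = R * exp (- c * t)" by (simp add: R_def algebra_simps)
    finally have "norm (sesq M (d t) (d t) - cnj (e t) * sesq M z (d t) - e t * sesq M (d t) z) \<le> R * exp (- c * t)" .
    then show ?thesis
      unfolding eq using complex_Re_le_cmod order_trans by fastforce
  qed
  \<comment> \<open>\<open>X\<close> bounds the transient and \<open>KV\<close> the harmonic part of
    the state, so the tail cost stays bounded independently of T.\<close>
  define X where "X = K1 * norm \<xi>"
  obtain KV where KV: "\<And>t. norm (mat (e t) *v \<xi>) \<le> KV"
  proof -
    obtain L1 where L1: "L1 > 0" "\<And>a. norm (mat a :: complex^'n^'n) \<le> norm a * L1"
      using bounded_linear.pos_bounded[OF bounded_linear_mat] by blast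
    obtain L2 where L2: "L2 > 0" "\<And>N (x :: complex^'n). norm ((N :: complex^'n^'n) *v x) \<le> norm N * norm x * L2"
      using bounded_bilinear.pos_bounded[OF bounded_bilinear_matrix_vector] by blast
    have "norm (mat (e t) *v \<xi>) \<le> L1 * norm \<xi> * L2" for t
      using L1(2)[of "e t"] L2(1) by (intro order_trans[OF L2(2)] mult_right_mono) (auto simp: en)
    then show thesis by (rule that)
  qed
  have x_bound: "norm (x t) \<le> KV + X" if t: "0 \<le> t" for t
  proof -
    have "norm (E t *v \<xi>) \<le> X * exp (- c * t)" using K1(2)[OF t] by (simp add: X_def)
    also have "\<dots> \<le> X" using K1(1) t c by (simp add: X_def mult_left_le)
    finally show ?thesis
      unfolding x_def using KV[of t] norm_triangle_ineq4[of "mat (e t) *v \<xi>" "E t *v \<xi>"] by linarith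
  qed
  \<comment> \<open>Only the first summand depends on T, so its coefficient cannot be
    negative.\<close>
  have main: "0 \<le> T * Re (cquad M z) + R / c + K * (KV + X)\<^sup>2" if T: "0 < T" for T
  proof -
    have sol: "is_solution A B 0 (S.ext_u T x u) (S.ext_x T x)"
      using S.ext_is_solution[OF T xc uc der] by (simp add: x0)
    have st: "state A B 0 (S.ext_u T x u) t = S.ext_x T x t" if "0 \<le> t" for t
      by (rule Y.state_eq[OF sol that])
    have "state A B 0 (S.ext_u T x u) \<in> L2_Rplus"
      by (rule L2_Rplus_cong[OF S.ext_L2(1)[OF T xc uc]]) (simp add: st)
    then have "0 \<le> cost A B M 0 (S.ext_u T x u)"
      using S.ext_L2(2)[OF T xc uc] by (intro cost) (simp add: admissible_inputs_def)
    also have "cost A B M 0 (S.ext_u T x u) = (LINT t:{0..}|lebesgue. cquad M (S.ext T x u t))"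
      unfolding cost_def set_lebesgue_integral_def
      by (intro Bochner_Integration.integral_cong) (auto simp: indicator_def st S.ext_def)
    finally have "0 \<le> Re (LINT t:{0..}|lebesgue. cquad M (S.ext T x u t))"
      by (simp add: less_eq_complex_def)
    moreover have "\<bar>Re ((LINT t:{0..}|lebesgue. cquad M (S.ext T x u t)) - (LINT t:{0..<T}|lebesgue. cquad M (vstack (x t) (u t))))\<bar>
        \<le> K * (norm (x T))\<^sup>2"
      by (rule order_trans[OF abs_Re_le_cmod tail[OF T xc uc]])
    moreover have "K * (norm (x T))\<^sup>2 \<le> K * (KV + X)\<^sup>2"
      using K T x_bound[of T] by (intro mult_left_mono power_mono) auto
    moreover have "Re (LINT t:{0..<T}|lebesgue. cquad M (vstack (x t) (u t))) \<le> T * Re (cquad M z) + R / c"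
    proof -
      have "set_integrable lebesgue {0..T} (\<lambda>t. cquad M (vstack (x t) (u t)))"
        by (intro absolutely_integrable_continuous_real continuous_intros continuous_on_subset[OF xc] continuous_on_subset[OF uc]) auto
      then have qi: "set_integrable lebesgue {0..<T} (\<lambda>t. cquad M (vstack (x t) (u t)))"
        by (rule set_integrable_subset) auto
      have ei: "set_integrable lebesgue {0..} (\<lambda>t. R * exp (- c * t))"
        using exp_decay_set_integrable[OF c] by simp
      have ei': "set_integrable lebesgue {0..<T} (\<lambda>t. R * exp (- c * t))"
        by (rule set_integrable_subset[OF ei]) auto
      have ci: "set_integrable lebesgue {0..<T} (\<lambda>t. Re (cquad M z))"
        by (rule set_integrable_subset[of _ "{0..T}"])
           (auto intro!: absolutely_integrable_continuous_real continuous_intros)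
      have "Re (LINT t:{0..<T}|lebesgue. cquad M (vstack (x t) (u t))) = (LINT t:{0..<T}|lebesgue. Re (cquad M (vstack (x t) (u t))))"
        using qi by (simp add: set_lebesgue_integral_def set_integrable_def flip: integral_Re)
      also have "\<dots> \<le> (LINT t:{0..<T}|lebesgue. Re (cquad M z) + R * exp (- c * t))"
        by (rule set_integral_mono[OF set_integrable_bounded_linear[OF bounded_linear_Re qi] set_integral_add(1)[OF ci ei']])
           (simp add: q_le[simplified])
      also have "\<dots> = (LINT t:{0..<T}|lebesgue. Re (cquad M z)) + (LINT t:{0..<T}|lebesgue. R * exp (- c * t))"
        by (rule set_integral_add(2)[OF ci ei'])
      also have "(LINT t:{0..<T}|lebesgue. Re (cquad M z)) = T * Re (cquad M z)"
        using T by (simp add: set_lebesgue_integral_def)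
      also have "(LINT t:{0..<T}|lebesgue. R * exp (- c * t)) \<le> (LINT t:{0..}|lebesgue. R * exp (- c * t))"
        unfolding set_lebesgue_integral_def
        by (rule integral_mono') (use ei R0 in \<open>auto simp: set_integrable_def indicator_def\<close>)
      also have "(LINT t:{0..}|lebesgue. R * exp (- c * t)) = R / c"
      proof -
        have "((\<lambda>t. R * exp (- c * t)) has_integral (R * (exp (- c * 0) / c))) {0..}"
          by (intro has_integral_mult_right has_integral_exp_minus_to_infinity c)
        from integral_unique[OF this] show ?thesis
          unfolding set_lebesgue_integral_eq_integral(2)[OF ei] by (rule trans) simp
      qed
      finally show ?thesis by simp
    qed
    ultimately show ?thesis by simp
  qed
  have "0 \<le> Re (cquad M z)"
  proof (rule ccontr)
    assume "\<not> 0 \<le> Re (cquad M z)"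
    then have neg: "Re (cquad M z) < 0" by simp
    define Q where "Q = R / c + K * (KV + X)\<^sup>2"
    have Q: "0 \<le> Q" using R0 c K by (simp add: Q_def)
    \<comment> \<open>At this horizon the right-hand side equals -(Q + 1) + Q = -1.\<close>
    have "0 \<le> (Q + 1) / (- Re (cquad M z)) * Re (cquad M z) + Q"
      using main[of "(Q + 1) / (- Re (cquad M z))"] neg Q unfolding Q_def
      by (simp add: divide_pos_neg)
    then show False using neg by simp
  qed
  then show "0 \<le> cquad (popov A B M \<omega>) w"
    unfolding popov_z using Im_cquad_hermitian[OF M, of z] by (simp add: less_eq_complex_def)
qed

theorem theorem1:
  fixes A :: "complex ^ 'n ^ 'n"
    and B :: "complex ^ 'm ^ 'n"
    and M :: "complex ^ ('n + 'm) ^ ('n + 'm)"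
    and W :: "complex ^ 'n ^ 'n"
    and V :: "complex ^ 'n ^ 'm"
    and R :: "complex ^ 'm ^ 'm"
  assumes "stabilizable A B"
    and "M = conj_transpose M"
    and "M = block_matrix W (conj_transpose V) V R"
    and "pos_def R"
  shows "(\<forall>u\<in>admissible_inputs A B. 0 \<le> cost A B M 0 u) \<longleftrightarrow>
         (\<forall>\<omega>::real. \<i> * of_real \<omega> \<notin> spectrum A \<longrightarrow> pos_semidef (popov A B M \<omega>))"
  using popov_imp_cost_nonneg[OF assms(1) assms(2)[symmetric]]
    cost_nonneg_imp_popov[OF assms(1) assms(2)[symmetric]] by blast

end
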